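(* Let $d\ge1$, let $G\subset\mathbb{R}^d$ be a bounded Lipschitz domain, let $G_0\subset G$ be a non-empty measurable subset of strictly positive Lebesgue measure, let $T>0$, $y_0\in L^2(G)\setminus\{0\}$ and $u\in L^2((0,T)\times G_0)$. For $\xi\in\mathbb{R}$ let $y(\cdot,\cdot;\xi;y_0;u)$ be the solution of $$\partial_t y-\xi\,\mathrm{i}\Delta y=\mathbf{1}_{G_0}u \ \text{ on }(0,T)\times G,\qquad y=0\ \text{ on }(0,T)\times\partial G,\qquad y(0,\cdot)=y_0\ \text{ in }G.$$ Then the set $$\mathcal{A}=\{\xi\in\mathbb{R}\;:\;y(T,\cdot;\xi;y_0;u)=0\}$$ is finite.
   Context: All function spaces are complex valued, $L^2(G)=L^2(G;\mathbb{C})$. $\Delta$ is the Laplacian on $L^2(G)$ with Dirichlet boundary conditions and $(e^{\mathrm{i}t\Delta})_{t\in\mathbb{R}}$ is the unitary group generated by $\mathrm{i}\Delta$. The solution is the one given by Duhamel's formula, $y(t,\cdot;\xi;y_0;u)=e^{\mathrm{i}t\xi\Delta}y_0+\int_0^t e^{\mathrm{i}(t-s)\xi\Delta}\mathbf{1}_{G_0}u(s,\cdot)\,ds\in C([0,T];L^2(G))$. *)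

theory Defs
  imports "HOL-Analysis.Analysis"
begin

subsection \<open>The Hilbert space $L^2(\mathbb{R}^d; \mathbb{C})$\<close>

text \<open>
  Square integrable complex functions on a Euclidean space modulo equality almost everywhere with
  respect to Lebesgue measure. The real inner product is the real part of the usual complex one,
  so the norm is the $L^2$ norm. The space is shown to be complete and separable, which
  gives access to the Bochner integral of the library.
\<close>

definition square_integrable :: "('a::euclidean_space \<Rightarrow> complex) \<Rightarrow> bool" where
  "square_integrable f \<longleftrightarrow>
     f \<in> borel_measurable lebesgue \<and> integrable lebesgue (\<lambda>x. (cmod (f x))\<^sup>2)"

lemma square_integrable_measurable:
  "square_integrable f \<Longrightarrow> f \<in> borel_measurable lebesgue"
  by (simp add: square_integrable_def)

lemma square_integrable_integrable:
  "square_integrable f \<Longrightarrow> integrable lebesgue (\<lambda>x. (cmod (f x))\<^sup>2)"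
  by (simp add: square_integrable_def)

lemma square_integrable_0: "square_integrable (\<lambda>_. 0)"
  by (simp add: square_integrable_def)

lemma square_integrable_mult:
  assumes "square_integrable f"
  shows "square_integrable (\<lambda>x. c * f x)"
  using assms by (auto simp: square_integrable_def norm_mult power_mult_distrib)

lemma square_integrable_bound:
  assumes "integrable lebesgue g" "f \<in> borel_measurable lebesgue"
    "AE x in lebesgue. (cmod (f x))\<^sup>2 \<le> g x"
  shows "square_integrable f"
proof -
  have "integrable lebesgue (\<lambda>x. (cmod (f x))\<^sup>2)"
    by (rule Bochner_Integration.integrable_bound[OF assms(1)])
       (use assms in \<open>auto elim!: eventually_mono\<close>)
  with assms(2) show ?thesis by (simp add: square_integrable_def)
qed

lemma norm_add_square_le:
  "(norm (a + b :: 'a::real_normed_vector))\<^sup>2 \<le> 2 * (norm a)\<^sup>2 + 2 * (norm b)\<^sup>2"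
proof -
  have "(norm (a + b))\<^sup>2 \<le> (norm a + norm b)\<^sup>2"
    by (intro power_mono norm_triangle_ineq) auto
  also have "\<dots> \<le> 2 * (norm a)\<^sup>2 + 2 * (norm b)\<^sup>2"
    using zero_le_power2[of "norm a - norm b"] by (simp add: power2_eq_square algebra_simps)
  finally show ?thesis .
qed

lemma square_integrable_add:
  assumes "square_integrable f" "square_integrable g"
  shows "square_integrable (\<lambda>x. f x + g x)"
  by (rule square_integrable_bound[where g = "\<lambda>x. 2 * (cmod (f x))\<^sup>2 + 2 * (cmod (g x))\<^sup>2"])
     (use assms in \<open>auto simp: square_integrable_def intro!: norm_add_square_le\<close>)

lemma square_integrable_diff:
  assumes "square_integrable f" "square_integrable g"
  shows "square_integrable (\<lambda>x. f x - g x)"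
  using square_integrable_add[OF assms(1) square_integrable_mult[OF assms(2), of "-1"]] by simp

lemma borel_measurable_cnj [measurable (raw)]:
  "f \<in> borel_measurable M \<Longrightarrow> (\<lambda>x. cnj (f x)) \<in> borel_measurable M"
  by (rule borel_measurable_continuous_on[where f = cnj]) (auto intro!: continuous_intros)

lemma square_integrable_prod:
  assumes "square_integrable f" "square_integrable g"
  shows "integrable lebesgue (\<lambda>x. f x * cnj (g x))"
proof (rule Bochner_Integration.integrable_bound)
  show "integrable lebesgue (\<lambda>x. (cmod (f x))\<^sup>2 + (cmod (g x))\<^sup>2)"
    using assms by (auto simp: square_integrable_def)
  have [measurable]: "f \<in> borel_measurable lebesgue" "g \<in> borel_measurable lebesgue"
    using assms by (auto simp: square_integrable_def)
  show "(\<lambda>x. f x * cnj (g x)) \<in> borel_measurable lebesgue"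
    by measurable
  have "a * b \<le> a\<^sup>2 + b\<^sup>2" if "a \<ge> 0" "b \<ge> 0" for a b :: real
  proof -
    have "2 * (a * b) \<le> a\<^sup>2 + b\<^sup>2"
      using zero_le_power2[of "a - b"] by (simp add: power2_eq_square algebra_simps)
    moreover have "0 \<le> a * b" using that by simp
    ultimately show ?thesis by linarith
  qed
  then show "AE x in lebesgue. norm (f x * cnj (g x)) \<le> norm ((cmod (f x))\<^sup>2 + (cmod (g x))\<^sup>2)"
    by (auto simp: norm_mult)
qed

definition l2_rel :: "('a::euclidean_space \<Rightarrow> complex) \<Rightarrow> ('a \<Rightarrow> complex) \<Rightarrow> bool" where
  "l2_rel f g \<longleftrightarrow>
     square_integrable f \<and> square_integrable g \<and> (AE x in lebesgue. f x = g x)"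

quotient_type (overloaded) 'a l2 = "'a::euclidean_space \<Rightarrow> complex" / partial: l2_rel
  morphisms rep_l2 abs_l2
proof (rule part_equivpI)
  show "\<exists>f. l2_rel f f"
    by (intro exI[of _ "\<lambda>_. 0"]) (simp add: l2_rel_def square_integrable_0)
  show "symp l2_rel"
    by (auto simp: symp_def l2_rel_def elim: eventually_mono)
  show "transp l2_rel"
    unfolding transp_def l2_rel_def
    by (intro allI impI conjI; elim conjE; (assumption | (erule (1) eventually_elim2, simp))?)
qed

instantiation l2 :: (euclidean_space) real_inner
begin

lift_definition zero_l2 :: "'a l2" is "\<lambda>_. 0"
  by (simp add: l2_rel_def square_integrable_0)

lift_definition plus_l2 :: "'a l2 \<Rightarrow> 'a l2 \<Rightarrow> 'a l2" is "\<lambda>f g x. f x + g x"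
  by (auto simp: l2_rel_def square_integrable_add)

lift_definition uminus_l2 :: "'a l2 \<Rightarrow> 'a l2" is "\<lambda>f x. - f x"
  using square_integrable_mult[of _ "-1"] by (auto simp: l2_rel_def)

lift_definition minus_l2 :: "'a l2 \<Rightarrow> 'a l2 \<Rightarrow> 'a l2" is "\<lambda>f g x. f x - g x"
  by (auto simp: l2_rel_def square_integrable_diff)

lift_definition scaleR_l2 :: "real \<Rightarrow> 'a l2 \<Rightarrow> 'a l2" is "\<lambda>r f x. of_real r * f x"
  by (auto simp: l2_rel_def square_integrable_mult)

lift_definition inner_l2 :: "'a l2 \<Rightarrow> 'a l2 \<Rightarrow> real"
  is "\<lambda>f g. Re (LINT x|lebesgue. f x * cnj (g x))"
  unfolding l2_rel_def
  by (intro arg_cong[of _ _ Re] integral_cong_AE)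
     (auto dest: square_integrable_prod[THEN borel_measurable_integrable])

definition norm_l2 :: "'a l2 \<Rightarrow> real" where
  "norm_l2 f = sqrt (inner f f)"

definition dist_l2 :: "'a l2 \<Rightarrow> 'a l2 \<Rightarrow> real" where
  "dist_l2 f g = norm (f - g)"

definition sgn_l2 :: "'a l2 \<Rightarrow> 'a l2" where
  "sgn_l2 f = inverse (norm f) *\<^sub>R f"

definition uniformity_l2 :: "('a l2 \<times> 'a l2) filter" where
  "uniformity_l2 = (INF e\<in>{0<..}. principal {(x, y). dist x y < e})"

definition open_l2 :: "'a l2 set \<Rightarrow> bool" where
  "open_l2 U \<longleftrightarrow> (\<forall>x\<in>U. \<forall>\<^sub>F (x', y) in uniformity. x' = x \<longrightarrow> y \<in> U)"

instance
proof
  fix f g h :: "'a l2" and r s :: real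
  show "f + g + h = f + (g + h)"
    by transfer (auto simp: l2_rel_def add.assoc intro!: square_integrable_add)
  show "f + g = g + f"
    by transfer (auto simp: l2_rel_def add.commute intro!: square_integrable_add)
  show "0 + f = f"
    by transfer (auto simp: l2_rel_def)
  show "- f + f = 0"
    by transfer (auto simp: l2_rel_def square_integrable_0)
  show "f - g = f + - g"
    by transfer (auto simp: l2_rel_def intro!: square_integrable_diff)
  show "r *\<^sub>R (f + g) = r *\<^sub>R f + r *\<^sub>R g"
    by transfer (auto simp: l2_rel_def distrib_left distrib_right
      intro!: square_integrable_mult square_integrable_add)
  show "(r + s) *\<^sub>R f = r *\<^sub>R f + s *\<^sub>R f"
    by transfer (auto simp: l2_rel_def distrib_left distrib_right
      intro!: square_integrable_mult square_integrable_add)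
  show "r *\<^sub>R s *\<^sub>R f = (r * s) *\<^sub>R f"
    by transfer (auto simp: l2_rel_def mult.assoc intro!: square_integrable_mult)
  show "1 *\<^sub>R f = f"
    by transfer (auto simp: l2_rel_def)
  show "dist f g = norm (f - g)" by (simp add: dist_l2_def)
  show "sgn f = inverse (norm f) *\<^sub>R f" by (simp add: sgn_l2_def)
  show "(uniformity :: ('a l2 \<times> 'a l2) filter) = (INF e\<in>{0<..}. principal {(x, y). dist x y < e})"
    by (simp add: uniformity_l2_def)
  show "open U \<longleftrightarrow> (\<forall>x\<in>U. \<forall>\<^sub>F (x', y) in uniformity. x' = x \<longrightarrow> y \<in> U)" for U :: "'a l2 set"
    by (simp add: open_l2_def)
  show "norm f = sqrt (inner f f)" by (simp add: norm_l2_def)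
  show "inner f g = inner g f"
  proof (transfer, goal_cases)
    case (1 f g)
    have "integral\<^sup>L lebesgue (\<lambda>x. g x * cnj (f x)) = cnj (integral\<^sup>L lebesgue (\<lambda>x. f x * cnj (g x)))"
      using Bochner_Integration.integral_cnj[of lebesgue "\<lambda>x. f x * cnj (g x)"] by (simp add: mult.commute)
    then show ?case by simp
  qed
  show "inner (f + g) h = inner f h + inner g h"
    by transfer (auto simp: l2_rel_def distrib_right square_integrable_prod)
  show "inner (r *\<^sub>R f) g = r * inner f g"
    by transfer (simp add: mult.assoc)
  have inner_self: "Re (LINT x|lebesgue. f x * cnj (f x)) = (LINT x|lebesgue. (cmod (f x))\<^sup>2)"
    for f :: "'a \<Rightarrow> complex"
    by (simp add: complex_norm_square[symmetric] del: of_real_power)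
  show "0 \<le> inner f f"
    by transfer (simp add: inner_self)
  show "inner f f = 0 \<longleftrightarrow> f = 0"
    by transfer
       (auto simp: inner_self l2_rel_def square_integrable_0 square_integrable_integrable
          integral_nonneg_eq_0_iff_AE)
qed

end

lemma norm_l2_abs:
  assumes "square_integrable f"
  shows "(norm (abs_l2 f))\<^sup>2 = (LINT x|lebesgue. (cmod (f x))\<^sup>2)"
proof -
  have "inner (abs_l2 f) (abs_l2 f) = Re (LINT x|lebesgue. f x * cnj (f x))"
    by (rule inner_l2.abs_eq) (use assms in \<open>auto simp: l2_rel_def\<close>)
  then show ?thesis
    by (simp add: power2_norm_eq_inner complex_norm_square[symmetric] del: of_real_power)
qed

lemma rep_l2_square_integrable: "square_integrable (rep_l2 f)"
  using Quotient3_rep_reflp[OF Quotient3_l2, of f] by (simp add: l2_rel_def)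

lemma abs_rep_l2: "abs_l2 (rep_l2 f) = f"
  using Quotient3_abs_rep[OF Quotient3_l2] .

lemma abs_l2_eq_iff:
  assumes "square_integrable f" "square_integrable g"
  shows "abs_l2 f = abs_l2 g \<longleftrightarrow> (AE x in lebesgue. f x = g x)"
  using Quotient3_rel[OF Quotient3_l2, of f g] assms by (auto simp: l2_rel_def)

lemma abs_l2_add:
  "square_integrable f \<Longrightarrow> square_integrable g \<Longrightarrow> abs_l2 (\<lambda>x. f x + g x) = abs_l2 f + abs_l2 g"
  using plus_l2.abs_eq[of f g] by (simp add: l2_rel_def)

lemma abs_l2_diff:
  "square_integrable f \<Longrightarrow> square_integrable g \<Longrightarrow> abs_l2 (\<lambda>x. f x - g x) = abs_l2 f - abs_l2 g"
  using minus_l2.abs_eq[of f g] by (simp add: l2_rel_def)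

lemma abs_l2_0: "abs_l2 (\<lambda>_. 0) = 0"
  by (simp add: zero_l2_def)

lemma abs_l2_scaleR:
  "square_integrable f \<Longrightarrow> abs_l2 (\<lambda>x. of_real r * f x) = r *\<^sub>R abs_l2 f"
  using scaleR_l2.abs_eq[of f r] by (simp add: l2_rel_def)

lemma dist_l2_abs:
  assumes "square_integrable f" "square_integrable g"
  shows "(dist (abs_l2 f) (abs_l2 g))\<^sup>2 = (LINT x|lebesgue. (cmod (f x - g x))\<^sup>2)"
  using norm_l2_abs[OF square_integrable_diff[OF assms]] abs_l2_diff[OF assms]
  by (simp add: dist_norm)

lemma tendsto_abs_l2:
  assumes "square_integrable f" "\<And>n. square_integrable (s n)"
    and "(\<lambda>n. LINT x|lebesgue. (cmod (s n x - f x))\<^sup>2) \<longlonglongrightarrow> 0"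
  shows "(\<lambda>n. abs_l2 (s n)) \<longlonglongrightarrow> abs_l2 f"
proof -
  have "(\<lambda>n. sqrt ((dist (abs_l2 (s n)) (abs_l2 f))\<^sup>2)) \<longlonglongrightarrow> sqrt 0"
    unfolding dist_l2_abs[OF assms(2,1)] by (rule tendsto_real_sqrt) (rule assms(3))
  then show ?thesis
    by (subst tendsto_dist_iff) simp
qed

lemma tendsto_abs_l2_dominated:
  assumes f: "square_integrable f" and s: "\<And>n. s n \<in> borel_measurable lebesgue"
    and bound: "\<And>n x. cmod (s n x) \<le> C * cmod (f x)"
    and lim: "\<And>x. (\<lambda>n. s n x) \<longlonglongrightarrow> f x"
  shows "square_integrable (s n)" "(\<lambda>n. abs_l2 (s n)) \<longlonglongrightarrow> abs_l2 f"
proof -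
  have si: "square_integrable (s n)" for n
  proof (rule square_integrable_bound)
    show "integrable lebesgue (\<lambda>x. C\<^sup>2 * (cmod (f x))\<^sup>2)"
      using f by (simp add: square_integrable_def)
    show "AE x in lebesgue. (cmod (s n x))\<^sup>2 \<le> C\<^sup>2 * (cmod (f x))\<^sup>2"
      using power_mono[OF bound, of _ _ 2] by (simp add: power_mult_distrib)
  qed (rule s)
  then show "square_integrable (s n)" .
  have [measurable]: "f \<in> borel_measurable lebesgue" "s n \<in> borel_measurable lebesgue" for n
    using f s by (auto simp: square_integrable_def)
  show "(\<lambda>n. abs_l2 (s n)) \<longlonglongrightarrow> abs_l2 f"
  proof (rule tendsto_abs_l2[OF f si])
    have "(\<lambda>n. LINT x|lebesgue. (cmod (s n x - f x))\<^sup>2) \<longlonglongrightarrow> (LINT x|(lebesgue :: 'a measure). 0)"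
    proof (rule integral_dominated_convergence)
      show "integrable lebesgue (\<lambda>x. (2 * C\<^sup>2 + 2) * (cmod (f x))\<^sup>2)"
        using f by (simp add: square_integrable_def)
      have "(\<lambda>n. (cmod (s n x - f x))\<^sup>2) \<longlonglongrightarrow> (cmod (f x - f x))\<^sup>2" for x
        by (intro tendsto_intros lim)
      then show "AE x in lebesgue. (\<lambda>n. (cmod (s n x - f x))\<^sup>2) \<longlonglongrightarrow> 0"
        by simp
      show "AE x in lebesgue. norm ((cmod (s n x - f x))\<^sup>2) \<le> (2 * C\<^sup>2 + 2) * (cmod (f x))\<^sup>2" for n
      proof (rule AE_I2)
        fix x
        have "(cmod (s n x + - f x))\<^sup>2 \<le> 2 * (cmod (s n x))\<^sup>2 + 2 * (cmod (- f x))\<^sup>2"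
          by (rule norm_add_square_le)
        also have "(cmod (s n x))\<^sup>2 \<le> C\<^sup>2 * (cmod (f x))\<^sup>2"
          using power_mono[OF bound, of _ _ 2] by (simp add: power_mult_distrib)
        finally show "norm ((cmod (s n x - f x))\<^sup>2) \<le> (2 * C\<^sup>2 + 2) * (cmod (f x))\<^sup>2"
          by (simp add: algebra_simps)
      qed
    qed measurable
    then show "(\<lambda>n. LINT x|lebesgue. (cmod (s n x - f x))\<^sup>2) \<longlonglongrightarrow> 0" by simp
  qed
qed

subsection \<open>Completeness\<close>

lemma l2_rapid_Cauchy_convergent:
  fixes X :: "nat \<Rightarrow> 'a::euclidean_space l2"
  assumes rapid: "\<And>n m. n \<le> m \<Longrightarrow> (dist (X n) (X m))\<^sup>2 \<le> (1/4) ^ n"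
  shows "convergent X"
proof -
  define g where "g n = rep_l2 (X n)" for n
  have g: "square_integrable (g n)" for n
    by (simp add: g_def rep_l2_square_integrable)
  have X: "X n = abs_l2 (g n)" for n
    by (simp add: g_def abs_rep_l2)
  have [measurable]: "g n \<in> borel_measurable lebesgue" for n
    using g by (simp add: square_integrable_def)
  have nn: "(\<integral>\<^sup>+x. ennreal ((cmod (g n x - g m x))\<^sup>2) \<partial>lebesgue) \<le> ennreal ((1/4) ^ n)"
    if "n \<le> m" for n m
  proof -
    have "(\<integral>\<^sup>+x. ennreal ((cmod (g n x - g m x))\<^sup>2) \<partial>lebesgue)
        = ennreal (LINT x|lebesgue. (cmod (g n x - g m x))\<^sup>2)"
      by (intro nn_integral_eq_integral square_integrable_integrable square_integrable_diff g) auto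
    also have "(LINT x|lebesgue. (cmod (g n x - g m x))\<^sup>2) = (dist (X n) (X m))\<^sup>2"
      unfolding X by (rule dist_l2_abs[OF g g, symmetric])
    also have "ennreal \<dots> \<le> ennreal ((1/4) ^ n)"
      by (intro ennreal_leI rapid that)
    finally show ?thesis .
  qed
  have AE_conv: "AE x in lebesgue. convergent (\<lambda>n. g n x)"
  proof -
    let ?h = "\<lambda>n x. ennreal (2 ^ n * (cmod (g n x - g (Suc n) x))\<^sup>2)"
    have "(\<integral>\<^sup>+x. (\<Sum>n. ?h n x) \<partial>lebesgue) = (\<Sum>n. \<integral>\<^sup>+x. ?h n x \<partial>lebesgue)"
      by (rule nn_integral_suminf) measurable
    also have "\<dots> \<le> (\<Sum>n. ennreal ((1/2) ^ n))"
    proof (rule suminf_le)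
      fix n
      have "(\<integral>\<^sup>+x. ?h n x \<partial>lebesgue)
          = ennreal (2 ^ n) * (\<integral>\<^sup>+x. ennreal ((cmod (g n x - g (Suc n) x))\<^sup>2) \<partial>lebesgue)"
        by (subst nn_integral_cmult[symmetric]) (auto simp: ennreal_mult)
      also have "\<dots> \<le> ennreal (2 ^ n) * ennreal ((1/4) ^ n)"
        by (intro mult_left_mono nn) auto
      also have "\<dots> = ennreal ((1/2) ^ n)"
        by (subst ennreal_mult[symmetric]) (auto simp: power_mult_distrib[symmetric])
      finally show "(\<integral>\<^sup>+x. ?h n x \<partial>lebesgue) \<le> ennreal ((1/2) ^ n)" .
    qed auto
    also have "\<dots> = ennreal (\<Sum>n. (1/2) ^ n)"
      by (rule suminf_ennreal2) (auto intro: summable_geometric)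
    finally have "(\<integral>\<^sup>+x. (\<Sum>n. ?h n x) \<partial>lebesgue) \<noteq> \<infinity>"
      by (metis ennreal_less_top infinity_ennreal_def leD)
    then have "AE x in lebesgue. (\<Sum>n. ?h n x) \<noteq> \<infinity>"
      by (intro nn_integral_PInf_AE) measurable
    then show ?thesis
    proof (rule eventually_mono)
      fix x assume fin: "(\<Sum>n. ?h n x) \<noteq> \<infinity>"
      define C where "C = enn2real (\<Sum>n. ?h n x)"
      have C: "ennreal C = (\<Sum>n. ?h n x)" "C \<ge> 0"
        using fin by (auto simp: C_def)
      have "cmod (g (Suc n) x - g n x) \<le> sqrt C * (sqrt (1/2)) ^ n" for n
      proof -
        have "?h n x \<le> ennreal C"
        proof -
          have "?h n x = (\<Sum>n\<in>{n}. ?h n x)" by simp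
          also have "\<dots> \<le> (\<Sum>n. ?h n x)" by (rule sum_le_suminf) auto
          also have "\<dots> = ennreal C" by (rule C(1)[symmetric])
          finally show ?thesis .
        qed
        then have "2 ^ n * (cmod (g n x - g (Suc n) x))\<^sup>2 \<le> C"
          using ennreal_le_iff[OF C(2)] by blast
        then have "(cmod (g (Suc n) x - g n x))\<^sup>2 \<le> C * (1/2) ^ n"
          by (simp add: norm_minus_commute field_simps)
        then have "cmod (g (Suc n) x - g n x) \<le> sqrt (C * (1/2) ^ n)"
          by (rule real_le_rsqrt)
        then show ?thesis by (simp add: real_sqrt_mult real_sqrt_power)
      qed
      moreover have "summable (\<lambda>n. sqrt C * (sqrt (1/2)) ^ n)"
        by (intro summable_mult summable_geometric) (simp add: real_sqrt_divide)
      ultimately have "summable (\<lambda>n. g (Suc n) x - g n x)"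
        by (rule summable_comparison_test'[rotated])
      then have "convergent (\<lambda>n. \<Sum>i<n. g (Suc i) x - g i x)"
        by (simp add: summable_iff_convergent)
      then have "convergent (\<lambda>n. (g n x - g 0 x) + g 0 x)"
        unfolding sum_lessThan_telescope[of "\<lambda>n. g n x"]
        by (intro convergent_add convergent_const)
      then show "convergent (\<lambda>n. g n x)" by simp
    qed
  qed
  define f where "f x = lim (\<lambda>n. g n x)" for x
  have [measurable]: "f \<in> borel_measurable lebesgue"
    unfolding f_def by measurable
  have AE_lim: "AE x in lebesgue. (\<lambda>n. g n x) \<longlonglongrightarrow> f x"
    using AE_conv by eventually_elim (simp add: f_def convergent_LIMSEQ_iff)
  have bound: "(\<integral>\<^sup>+x. ennreal ((cmod (g n x - f x))\<^sup>2) \<partial>lebesgue) \<le> ennreal ((1/4) ^ n)" for n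
  proof -
    have "(\<integral>\<^sup>+x. ennreal ((cmod (g n x - f x))\<^sup>2) \<partial>lebesgue)
        = (\<integral>\<^sup>+x. liminf (\<lambda>m. ennreal ((cmod (g n x - g m x))\<^sup>2)) \<partial>lebesgue)"
    proof (rule nn_integral_cong_AE)
      show "AE x in lebesgue. ennreal ((cmod (g n x - f x))\<^sup>2)
          = liminf (\<lambda>m. ennreal ((cmod (g n x - g m x))\<^sup>2))"
        using AE_lim
      proof eventually_elim
        case (elim x)
        have "(\<lambda>m. ennreal ((cmod (g n x - g m x))\<^sup>2)) \<longlonglongrightarrow> ennreal ((cmod (g n x - f x))\<^sup>2)"
          by (intro tendsto_ennrealI tendsto_intros elim)
        from lim_imp_Liminf[OF _ this] show ?case by simp
      qed
    qed
    also have "\<dots> \<le> liminf (\<lambda>m. \<integral>\<^sup>+x. ennreal ((cmod (g n x - g m x))\<^sup>2) \<partial>lebesgue)"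
      by (rule nn_integral_liminf) measurable
    also have "\<dots> \<le> liminf (\<lambda>m. ennreal ((1/4) ^ n))"
      by (rule Liminf_mono) (use nn in \<open>auto simp: eventually_at_top_linorder\<close>)
    also have "\<dots> = ennreal ((1/4) ^ n)"
      by (simp add: Liminf_const)
    finally show ?thesis .
  qed
  have diff: "square_integrable (\<lambda>x. g n x - f x)" for n
    unfolding square_integrable_def
    using bound[of n] by (auto intro!: integrableI_bounded simp: order.strict_trans1)
  have f: "square_integrable f"
    using square_integrable_diff[OF g diff, of 0 0] by simp
  have "(\<lambda>n. abs_l2 (g n)) \<longlonglongrightarrow> abs_l2 f"
  proof (rule tendsto_abs_l2[OF f g])
    have "(LINT x|lebesgue. (cmod (g n x - f x))\<^sup>2) \<le> (1/4) ^ n" for n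
    proof -
      have "ennreal (LINT x|lebesgue. (cmod (g n x - f x))\<^sup>2)
          = (\<integral>\<^sup>+x. ennreal ((cmod (g n x - f x))\<^sup>2) \<partial>lebesgue)"
        by (intro nn_integral_eq_integral[symmetric] square_integrable_integrable diff) auto
      also note bound
      finally show ?thesis by (simp add: ennreal_le_iff)
    qed
    then show "(\<lambda>n. LINT x|lebesgue. (cmod (g n x - f x))\<^sup>2) \<longlonglongrightarrow> 0"
      by (intro tendsto_sandwich[OF _ _ tendsto_const LIMSEQ_realpow_zero[of "1/4"]])
         (auto intro!: always_eventually)
  qed
  then show ?thesis
    unfolding X by (rule convergentI)
qed

instance l2 :: (euclidean_space) complete_space
proof
  fix X :: "nat \<Rightarrow> 'a l2" assume "Cauchy X"
  have "\<exists>N. \<forall>m\<ge>N. \<forall>n\<ge>N. dist (X m) (X n) < (1/2) ^ k" for k :: nat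
    using \<open>Cauchy X\<close> by (simp add: Cauchy_def)
  then obtain N where N: "\<And>k m n. m \<ge> N k \<Longrightarrow> n \<ge> N k \<Longrightarrow> dist (X m) (X n) < (1/2) ^ k"
    by metis
  define r where "r k = (\<Sum>i\<le>k. Suc (N i))" for k
  have r_mono: "strict_mono r"
    by (auto simp: strict_mono_Suc_iff r_def)
  have rN: "N k \<le> r k" for k
    by (cases k) (auto simp: r_def)
  have "convergent (\<lambda>k. X (r k))"
  proof (rule l2_rapid_Cauchy_convergent)
    fix n m :: nat assume "n \<le> m"
    then have "N n \<le> r m"
      using rN[of n] strict_mono_leD[OF r_mono] by (meson order_trans)
    then have "dist (X (r n)) (X (r m)) \<le> (1/2) ^ n"
      using N[OF rN[of n]] by (simp add: less_imp_le)
    then have "(dist (X (r n)) (X (r m)))\<^sup>2 \<le> ((1/2) ^ n)\<^sup>2"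
      by (intro power_mono) auto
    also have "\<dots> = (1/4) ^ n"
      by (simp add: power2_eq_square power_mult_distrib[symmetric])
    finally show "(dist (X (r n)) (X (r m)))\<^sup>2 \<le> (1/4) ^ n" .
  qed
  then obtain l where "(X \<circ> r) \<longlonglongrightarrow> l"
    by (auto simp: convergent_def o_def)
  then show "convergent X"
    using \<open>Cauchy X\<close> r_mono by (blast intro: convergentI Cauchy_converges_subseq)
qed

instance l2 :: (euclidean_space) banach ..

subsection \<open>Separability\<close>

lemma dense_imp_countable_basis:
  fixes D :: "'a::metric_space set"
  assumes "countable D" "closure D = UNIV"
  shows "\<exists>B::'a set set. countable B \<and> open = generate_topology B"
proof (intro exI conjI)
  let ?B = "(\<lambda>(d, n). ball d (1 / real (Suc n))) ` (D \<times> (UNIV :: nat set))"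
  show "countable ?B"
    using assms(1) by (intro countable_image countable_SIGMA) auto
  show "open = generate_topology ?B"
  proof (rule topological_basis_imp_subbasis, rule topological_basisI)
    fix U :: "'a set" and x assume "open U" "x \<in> U"
    then obtain e where e: "e > 0" "ball x e \<subseteq> U"
      by (meson openE)
    obtain n where n: "1 / real (Suc n) < e / 2"
      by (rule nat_approx_posE[of "e / 2"]) (use e(1) in simp)
    have "x \<in> closure D" by (simp add: assms(2))
    moreover have "0 < 1 / real (Suc n)" by simp
    ultimately obtain d where d: "d \<in> D" "dist d x < 1 / real (Suc n)"
      unfolding closure_approachable by blast
    have "ball d (1 / real (Suc n)) \<subseteq> ball x e"
    proof
      fix y assume "y \<in> ball d (1 / real (Suc n))"
      then have "dist x y < 1 / real (Suc n) + 1 / real (Suc n)"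
        using d(2) dist_triangle[of x y d] by (simp add: dist_commute)
      then show "y \<in> ball x e" using n by simp
    qed
    with e(2) have "x \<in> ball d (1 / real (Suc n)) \<and> ball d (1 / real (Suc n)) \<subseteq> U"
      using d(2) by auto
    moreover have "ball d (1 / real (Suc n)) \<in> ?B"
      using d(1) by (intro image_eqI[of _ _ "(d, n)"]) auto
    ultimately show "\<exists>B\<in>?B. x \<in> B \<and> B \<subseteq> U" by (rule bexI)
  qed auto
qed

lemma subspace_closure:
  fixes S :: "'a::real_normed_vector set"
  assumes "subspace S"
  shows "subspace (closure S)"
  unfolding subspace_def
proof (intro conjI ballI allI)
  show "0 \<in> closure S"
    using subspace_0[OF assms] by (rule closure_subset[THEN subsetD])
next
  fix x y assume "x \<in> closure S" "y \<in> closure S"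
  then obtain xs ys where "\<And>n. xs n \<in> S" "xs \<longlonglongrightarrow> x" "\<And>n. ys n \<in> S" "ys \<longlonglongrightarrow> y"
    unfolding closure_sequential by blast
  then show "x + y \<in> closure S"
    unfolding closure_sequential
    by (intro exI[of _ "\<lambda>n. xs n + ys n"] conjI allI tendsto_add subspace_add[OF assms])
next
  fix r :: real and x assume "x \<in> closure S"
  then obtain xs where "\<And>n. xs n \<in> S" "xs \<longlonglongrightarrow> x"
    unfolding closure_sequential by blast
  then show "r *\<^sub>R x \<in> closure S"
    unfolding closure_sequential
    by (intro exI[of _ "\<lambda>n. r *\<^sub>R xs n"] conjI allI tendsto_intros subspace_scale[OF assms])
qed

lemma countable_span_dense:
  fixes S :: "'a::real_normed_vector set"
  assumes "countable S" "closure (span S) = UNIV"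
  shows "\<exists>D::'a set. countable D \<and> closure D = UNIV"
proof (intro exI conjI)
  define c where "c l = (\<Sum>(q, s)\<leftarrow>l. real_of_rat q *\<^sub>R s)" for l :: "(rat \<times> 'a) list"
  let ?D = "c ` lists (UNIV \<times> S)"
  show "countable ?D"
    using assms(1) by (intro countable_image countable_lists countable_SIGMA) auto
  have add: "c l + c l' = c (l @ l')" for l l'
    by (simp add: c_def)
  have scale: "real_of_rat q *\<^sub>R c l = c (map (\<lambda>(p, s). (q * p, s)) l)" for q l
    by (induction l) (auto simp: c_def scaleR_add_right of_rat_mult)
  have "subspace (closure ?D)"
    unfolding subspace_def
  proof (intro conjI ballI allI)
    have "c [] \<in> ?D" by (rule imageI) simp
    then have "c [] \<in> closure ?D" by (rule closure_subset[THEN subsetD])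
    then show "0 \<in> closure ?D" by (simp add: c_def)
  next
    fix x y assume "x \<in> closure ?D" "y \<in> closure ?D"
    then obtain xs ys where "\<And>n. xs n \<in> ?D" "xs \<longlonglongrightarrow> x" "\<And>n. ys n \<in> ?D" "ys \<longlonglongrightarrow> y"
      unfolding closure_sequential by blast
    moreover have D_add: "a + b \<in> ?D" if "a \<in> ?D" "b \<in> ?D" for a b
    proof -
      from that(1) obtain l where l: "a = c l" "l \<in> lists (UNIV \<times> S)"
        by (rule imageE)
      from that(2) obtain l' where l': "b = c l'" "l' \<in> lists (UNIV \<times> S)"
        by (rule imageE)
      show ?thesis
        unfolding l(1) l'(1) add using l(2) l'(2) by (intro imageI) auto
    qed
    ultimately show "x + y \<in> closure ?D"
      unfolding closure_sequential
      by (intro exI[of _ "\<lambda>n. xs n + ys n"] conjI allI tendsto_add D_add)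
  next
    fix r :: real and x assume "x \<in> closure ?D"
    then obtain xs where xs: "\<And>n. xs n \<in> ?D" "xs \<longlonglongrightarrow> x"
      unfolding closure_sequential by blast
    have "r \<in> closure \<rat>" by (simp add: Rats_closure_real)
    then obtain q where q: "\<And>n. q n \<in> \<rat>" "q \<longlonglongrightarrow> r"
      unfolding closure_sequential by blast
    have D_scale: "p *\<^sub>R a \<in> ?D" if "p \<in> \<rat>" "a \<in> ?D" for p a
    proof -
      from that(1) obtain q where q: "p = real_of_rat q"
        by (rule Rats_cases)
      from that(2) obtain l where l: "a = c l" "l \<in> lists (UNIV \<times> S)"
        by (rule imageE)
      show ?thesis
        unfolding q l(1) scale using l(2) by (intro imageI) auto
    qed
    with xs q show "r *\<^sub>R x \<in> closure ?D"
      unfolding closure_sequential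
      by (intro exI[of _ "\<lambda>n. q n *\<^sub>R xs n"] conjI allI tendsto_scaleR D_scale)
  qed
  moreover have "S \<subseteq> closure ?D"
  proof
    fix s assume "s \<in> S"
    then have "c [(1, s)] \<in> ?D" by (intro imageI) auto
    then have "c [(1, s)] \<in> closure ?D" by (rule closure_subset[THEN subsetD])
    then show "s \<in> closure ?D" by (simp add: c_def)
  qed
  ultimately have "span S \<subseteq> closure ?D"
    by (rule span_minimal[rotated])
  then have "closure (span S) \<subseteq> closure ?D"
    by (simp add: closure_minimal)
  then show "closure ?D = UNIV" by (simp add: assms(2) top.extremum_unique)
qed

lemma square_integrable_indicator:
  assumes "A \<in> lmeasurable"
  shows "square_integrable (\<lambda>x. indicator A x *\<^sub>R c)"
proof (rule square_integrable_bound)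
  show "integrable lebesgue (\<lambda>x. indicat_real A x *\<^sub>R (cmod c)\<^sup>2)"
    using assms by (intro integrable_scaleR_left integrable_real_indicator) (auto simp: fmeasurable_def)
  show "(\<lambda>x. indicat_real A x *\<^sub>R c) \<in> borel_measurable lebesgue"
    using assms by (intro borel_measurable_scaleR) (auto simp: fmeasurable_def)
qed (auto simp: indicator_def)

definition l2_indicators :: "'a::euclidean_space set set \<Rightarrow> 'a l2 set" where
  "l2_indicators \<A> = (\<lambda>(A, c). abs_l2 (\<lambda>x. indicator A x *\<^sub>R c)) ` (\<A> \<times> {1, \<i>})"

lemma l2_indicators_dense:
  assumes V: "subspace V" "closed V" and ind: "l2_indicators lmeasurable \<subseteq> V"
  shows "f \<in> V"
proof -
  have ind1: "abs_l2 (\<lambda>x. indicat_real A x *\<^sub>R c) \<in> V" if A: "A \<in> lmeasurable" for A c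
  proof -
    have "abs_l2 (\<lambda>x. indicat_real A x *\<^sub>R d) \<in> V" if "d \<in> {1, \<i>}" for d
      using ind A that by (force simp: l2_indicators_def)
    then have "Re c *\<^sub>R abs_l2 (\<lambda>x. indicat_real A x *\<^sub>R 1)
             + Im c *\<^sub>R abs_l2 (\<lambda>x. indicat_real A x *\<^sub>R \<i>) \<in> V"
      using V(1) by (intro subspace_add subspace_scale) auto
    also have "Re c *\<^sub>R abs_l2 (\<lambda>x. indicat_real A x *\<^sub>R 1)
             + Im c *\<^sub>R abs_l2 (\<lambda>x. indicat_real A x *\<^sub>R \<i>)
        = abs_l2 (\<lambda>x. of_real (Re c) * (indicat_real A x *\<^sub>R 1)
             + of_real (Im c) * (indicat_real A x *\<^sub>R \<i>))"
      using A by (simp only: abs_l2_add abs_l2_scaleR square_integrable_mult square_integrable_indicator)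
    also have "(\<lambda>x. of_real (Re c) * (indicat_real A x *\<^sub>R 1)
             + of_real (Im c) * (indicat_real A x *\<^sub>R \<i>)) = (\<lambda>x. indicat_real A x *\<^sub>R c)"
      by (auto simp: fun_eq_iff complex_eq_iff indicator_def)
    finally show ?thesis .
  qed
  define g where "g = rep_l2 f"
  have g: "square_integrable g"
    by (simp add: g_def rep_l2_square_integrable)
  obtain s where s: "\<And>i. simple_function lebesgue (s i)" "\<And>x. (\<lambda>i. s i x) \<longlonglongrightarrow> g x"
      "\<And>i x. cmod (s i x) \<le> 2 * cmod (g x)"
    using borel_measurable_implies_sequence_metric[OF square_integrable_measurable[OF g], of 0]
    by auto
  have s_meas: "s i \<in> borel_measurable lebesgue" for i
    using s(1) by (rule borel_measurable_simple_function)
  note lim = tendsto_abs_l2_dominated[OF g s_meas s(3) s(2)]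
  have "abs_l2 (s i) \<in> V" for i
  proof -
    define A where "A y = s i -` {y}" for y
    have fin: "finite (range (s i))"
      using simple_functionD(1)[OF s(1), of i] by simp
    have sets: "A y \<in> sets lebesgue" for y
      using simple_functionD(2)[OF s(1), of i "{y}"] by (simp add: A_def)
    have lm: "A y \<in> lmeasurable" if "y \<noteq> 0" for y
    proof -
      have "integrable lebesgue (indicat_real (A y))"
      proof (rule Bochner_Integration.integrable_bound)
        show "integrable lebesgue (\<lambda>x. (cmod (s i x))\<^sup>2 / (cmod y)\<^sup>2)"
          by (intro integrable_divide square_integrable_integrable lim(1))
        show "indicat_real (A y) \<in> borel_measurable lebesgue"
          using sets by simp
        show "AE x in lebesgue. norm (indicat_real (A y) x) \<le> norm ((cmod (s i x))\<^sup>2 / (cmod y)\<^sup>2)"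
          using that by (intro AE_I2) (auto simp: indicator_def A_def)
      qed
      then show ?thesis
        using sets by (simp add: integrable_indicator_iff fmeasurable_def)
    qed
    have "square_integrable (\<lambda>x. \<Sum>y\<in>Y. indicat_real (A y) x *\<^sub>R y)
        \<and> abs_l2 (\<lambda>x. \<Sum>y\<in>Y. indicat_real (A y) x *\<^sub>R y) \<in> V"
      if "finite Y" "0 \<notin> Y" for Y
      using that
    proof (induction Y rule: finite_induct)
      case empty
      then show ?case
        using V(1) by (simp add: square_integrable_0 abs_l2_0 subspace_0)
    next
      case (insert y Y)
      have si: "square_integrable (\<lambda>x. indicat_real (A y) x *\<^sub>R y)"
        using insert by (intro square_integrable_indicator lm) auto
      have "abs_l2 (\<lambda>x. indicat_real (A y) x *\<^sub>R y) \<in> V"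
        using insert by (intro ind1 lm) auto
      then show ?case
        using insert.IH insert.prems si V(1)
        by (simp add: sum.insert[OF insert.hyps] abs_l2_add square_integrable_add subspace_add
            del: sum.insert)
    qed
    from this[of "range (s i) - {0}"]
    have "abs_l2 (\<lambda>x. \<Sum>y\<in>range (s i) - {0}. indicat_real (A y) x *\<^sub>R y) \<in> V"
      using fin by auto
    moreover have "(\<Sum>y\<in>range (s i) - {0}. indicat_real (A y) x *\<^sub>R y) = s i x" for x
    proof -
      have "s i x = (\<Sum>y\<in>range (s i). indicat_real (A y) x *\<^sub>R y)"
        using simple_function_indicator_representation_banach[OF s(1), of x i]
        by (simp only: A_def space_completion space_lborel space_borel Int_UNIV_right UNIV_I)
      also have "\<dots> = (\<Sum>y\<in>range (s i) - {0}. indicat_real (A y) x *\<^sub>R y)"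
        using fin by (intro sum.mono_neutral_right) auto
      finally show ?thesis by (rule sym)
    qed
    ultimately show ?thesis by simp
  qed
  then have "abs_l2 g \<in> V"
    using V(2)[unfolded closed_sequential_limits, rule_format, of "\<lambda>i. abs_l2 (s i)"] lim(2) by blast
  then show ?thesis by (simp add: g_def abs_rep_l2)
qed

lemma l2_separable: "\<exists>D :: 'a::euclidean_space l2 set. countable D \<and> closure D = UNIV"
proof -
  obtain B :: "'a set set" where B: "countable B" "topological_basis B"
    using ex_countable_basis by blast
  define \<A> where "\<A> = lmeasurable \<inter> Union ` {F. finite F \<and> F \<subseteq> B}"
  define V where "V = closure (span (l2_indicators \<A>))"
  have "countable \<A>"
    unfolding \<A>_def
    by (intro countable_Int2 countable_image countable_Collect_finite_subset B)
  then have S: "countable (l2_indicators \<A>)"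
    unfolding l2_indicators_def by (intro countable_image countable_SIGMA) auto
  have V: "subspace V" "closed V"
    by (auto simp: V_def intro: subspace_closure)
  have closedV: "l \<in> V" if "\<And>n. x n \<in> V" "x \<longlonglongrightarrow> l" for x l
    using V(2)[unfolded closed_sequential_limits, rule_format, of x] that by blast
  have ind\<A>: "abs_l2 (\<lambda>x. indicat_real A x *\<^sub>R c) \<in> V" if "A \<in> \<A>" "c \<in> {1, \<i>}" for A c
  proof -
    have "abs_l2 (\<lambda>x. indicat_real A x *\<^sub>R c) \<in> l2_indicators \<A>"
      using that by (force simp: l2_indicators_def)
    then show ?thesis
      unfolding V_def using closure_subset span_superset by blast
  qed
  have indU: "abs_l2 (\<lambda>x. indicat_real U x *\<^sub>R c) \<in> V"
    if U: "open U" "U \<in> lmeasurable" and c: "c \<in> {1, \<i>}" for U :: "'a set" and c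
  proof -
    obtain B' where B': "B' \<subseteq> B" "U = \<Union>B'"
      using U(1) B(2) by (auto simp: topological_basis_def)
    show ?thesis
    proof (cases "B' = {}")
      case True
      then show ?thesis
        using V(1) B' by (simp add: abs_l2_0 subspace_0)
    next
      case False
      define b where "b = from_nat_into B'"
      have b: "range b = B'"
        unfolding b_def using False B'(1) B(1) by (meson countable_subset range_from_nat_into)
      define W where "W n = \<Union>(b ` {..n})" for n
      have W: "W n \<in> lmeasurable" "W n \<subseteq> U" for n
      proof -
        show sub: "W n \<subseteq> U" using b B' by (auto simp: W_def)
        have "open (W n)"
          using b B' B(2) by (auto simp: W_def topological_basis_def)
        then show "W n \<in> lmeasurable"
          using fmeasurableI2[OF U(2) sub] by (simp add: borel_open)
      qed
      have "W n \<in> \<A>" for n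
        using W(1)[of n] b B'(1) by (auto simp: \<A>_def W_def)
      then have "abs_l2 (\<lambda>x. indicat_real (W n) x *\<^sub>R c) \<in> V" for n
        using ind\<A> c by blast
      moreover have "(\<lambda>n. abs_l2 (\<lambda>x. indicat_real (W n) x *\<^sub>R c)) \<longlonglongrightarrow> abs_l2 (\<lambda>x. indicat_real U x *\<^sub>R c)"
      proof (rule tendsto_abs_l2_dominated(2)[where C = 1])
        show "square_integrable (\<lambda>x. indicat_real U x *\<^sub>R c)"
          using U(2) by (rule square_integrable_indicator)
        show "(\<lambda>x. indicat_real (W n) x *\<^sub>R c) \<in> borel_measurable lebesgue" for n
          using square_integrable_indicator[OF W(1)] by (rule square_integrable_measurable)
        show "cmod (indicat_real (W n) x *\<^sub>R c) \<le> 1 * cmod (indicat_real U x *\<^sub>R c)" for n x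
          using W(2)[of n] by (auto simp: indicator_def)
        have "incseq W" unfolding W_def incseq_def by (intro allI impI Union_mono image_mono) auto
        moreover have "(\<Union>n. W n) = U"
          unfolding B'(2) b[symmetric] by (auto simp: W_def)
        ultimately show "(\<lambda>n. indicat_real (W n) x *\<^sub>R c) \<longlonglongrightarrow> indicat_real U x *\<^sub>R c" for x
          using LIMSEQ_indicator_incseq[of W x] by (intro tendsto_scaleR) auto
      qed
      ultimately show ?thesis by (rule closedV)
    qed
  qed
  have "abs_l2 (\<lambda>x. indicat_real A x *\<^sub>R c) \<in> V"
    if A: "A \<in> lmeasurable" and c: "c \<in> {1, \<i>}" for A :: "'a set" and c
  proof -
    have "\<exists>T. open T \<and> A \<subseteq> T \<and> T - A \<in> lmeasurable
        \<and> emeasure lebesgue (T - A) < ennreal (1 / real (Suc n))" for n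
    proof -
      have "A \<in> sets lebesgue" "0 < 1 / real (Suc n)"
        using A by auto
      then show ?thesis
        by (rule sets_lebesgue_outer_open) blast
    qed
    then obtain T where T: "\<And>n. open (T n)" "\<And>n. A \<subseteq> T n" "\<And>n. T n - A \<in> lmeasurable"
        "\<And>n. emeasure lebesgue (T n - A) < ennreal (1 / real (Suc n))"
      by metis
    have Tl: "T n \<in> lmeasurable" for n
      using fmeasurable.Un[OF A T(3)[of n]] T(2)[of n] by (simp add: Un_absorb1)
    have meas: "measure lebesgue (T n - A) \<le> 1 / real (Suc n)" for n
      unfolding measure_def using T(4)[of n] by (intro enn2real_leI less_imp_le) auto
    have "(\<lambda>n. abs_l2 (\<lambda>x. indicat_real (T n) x *\<^sub>R c)) \<longlonglongrightarrow> abs_l2 (\<lambda>x. indicat_real A x *\<^sub>R c)"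
    proof (rule tendsto_abs_l2)
      show "square_integrable (\<lambda>x. indicat_real A x *\<^sub>R c)"
        "square_integrable (\<lambda>x. indicat_real (T n) x *\<^sub>R c)" for n
        using A Tl by (auto intro: square_integrable_indicator)
      have "(LINT x|lebesgue. (cmod (indicat_real (T n) x *\<^sub>R c - indicat_real A x *\<^sub>R c))\<^sup>2)
          = measure lebesgue (T n - A)" for n
      proof -
        have "(cmod (indicat_real (T n) x *\<^sub>R c - indicat_real A x *\<^sub>R c))\<^sup>2
            = indicat_real (T n - A) x" for x
          using T(2)[of n] c by (auto simp: indicator_def)
        then show ?thesis by simp
      qed
      then show "(\<lambda>n. LINT x|lebesgue. (cmod (indicat_real (T n) x *\<^sub>R c - indicat_real A x *\<^sub>R c))\<^sup>2)
          \<longlonglongrightarrow> 0"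
        using meas
        by (intro tendsto_sandwich[OF _ _ tendsto_const LIMSEQ_inverse_real_of_nat])
           (auto intro!: always_eventually simp: inverse_eq_divide)
    qed
    moreover have "abs_l2 (\<lambda>x. indicat_real (T n) x *\<^sub>R c) \<in> V" for n
      using indU T(1) Tl c by blast
    ultimately show ?thesis by (rule closedV[rotated])
  qed
  then have "l2_indicators lmeasurable \<subseteq> V"
    by (auto simp: l2_indicators_def)
  then have "closure (span (l2_indicators \<A>)) = UNIV"
    unfolding V_def[symmetric] using l2_indicators_dense[OF V] by blast
  with S show ?thesis by (rule countable_span_dense)
qed

instance l2 :: (euclidean_space) second_countable_topology
proof
  show "\<exists>B :: 'a l2 set set. countable B \<and> open = generate_topology B"
    using l2_separable by (elim exE conjE) (rule dense_imp_countable_basis)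
qed

subsection \<open>Complex structure and the subspaces $L^2(A)$\<close>

lift_definition scaleC_l2 :: "complex \<Rightarrow> 'a::euclidean_space l2 \<Rightarrow> 'a l2" (infixr "*\<^sub>C" 75)
  is "\<lambda>c f x. c * f x"
  by (auto simp: l2_rel_def square_integrable_mult)

definition to_l2 :: "('a::euclidean_space \<Rightarrow> complex) \<Rightarrow> 'a l2" where
  "to_l2 f = (if square_integrable f then abs_l2 f else 0)"

text \<open>
  $L^2(A)$ is the subspace of those classes of $L^2(\mathbb{R}^d)$ that vanish almost everywhere
  outside $A$, i.e. elements of $L^2(A)$ are identified with their extensions by zero.
\<close>
definition L2_on :: "'a::euclidean_space set \<Rightarrow> 'a l2 set" where
  "L2_on A = {f. AE x in lebesgue. x \<notin> A \<longrightarrow> rep_l2 f x = 0}"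

subsection \<open>Bounded Lipschitz domains\<close>

text \<open>
  Near every boundary point, and up to a choice of the unit vector \<open>e\<close> as the last coordinate
  direction, the domain is exactly the region above the graph of a Lipschitz function \<open>\<gamma>\<close>
  of the remaining coordinates; these are the points of the hyperplane orthogonal to \<open>e\<close>.
\<close>
definition lipschitz_domain :: "'a::euclidean_space set \<Rightarrow> bool" where
  "lipschitz_domain G \<longleftrightarrow> open G \<and> connected G \<and> G \<noteq> {} \<and>
     (\<forall>x\<in>frontier G. \<exists>r>0. \<exists>e L. \<exists>\<gamma> :: 'a \<Rightarrow> real.
        norm e = 1 \<and> L-lipschitz_on {z. z \<bullet> e = 0} \<gamma> \<and>
        (\<forall>z\<in>ball x r. z \<in> G \<longleftrightarrow> \<gamma> (z - (z \<bullet> e) *\<^sub>R e) < z \<bullet> e))"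

subsection \<open>The Dirichlet Laplacian\<close>

definition dir_deriv :: "'a::real_normed_vector \<Rightarrow> ('a \<Rightarrow> complex) \<Rightarrow> 'a \<Rightarrow> complex" where
  "dir_deriv v f = (\<lambda>x. frechet_derivative f (at x) v)"

primrec C_k :: "nat \<Rightarrow> ('a::real_normed_vector \<Rightarrow> complex) \<Rightarrow> bool" where
  "C_k 0 f \<longleftrightarrow> continuous_on UNIV f"
| "C_k (Suc k) f \<longleftrightarrow> (\<forall>x. f differentiable (at x)) \<and> (\<forall>v. C_k k (dir_deriv v f))"

definition test_functions :: "'a::euclidean_space set \<Rightarrow> ('a \<Rightarrow> complex) set" where
  "test_functions G =
     {\<phi>. (\<forall>k. C_k k \<phi>) \<and> compact (closure {x. \<phi> x \<noteq> 0}) \<and> closure {x. \<phi> x \<noteq> 0} \<subseteq> G}"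

definition laplacian :: "('a::euclidean_space \<Rightarrow> complex) \<Rightarrow> 'a \<Rightarrow> complex" where
  "laplacian \<phi> = (\<lambda>x. \<Sum>b\<in>Basis. dir_deriv b (dir_deriv b \<phi>) x)"

definition weak_partial :: "'a::euclidean_space set \<Rightarrow> 'a \<Rightarrow> 'a l2 \<Rightarrow> 'a l2 \<Rightarrow> bool" where
  "weak_partial G b f g \<longleftrightarrow> f \<in> L2_on G \<and> g \<in> L2_on G \<and>
     (\<forall>\<phi>\<in>test_functions G.
        (LINT x|lebesgue. rep_l2 f x * dir_deriv b \<phi> x) = - (LINT x|lebesgue. rep_l2 g x * \<phi> x))"

definition sobolev_H1 :: "'a::euclidean_space set \<Rightarrow> 'a l2 set" where
  "sobolev_H1 G = {f \<in> L2_on G. \<forall>b\<in>Basis. \<exists>g. weak_partial G b f g}"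

text \<open>
  $H^1_0(G)$ is the closure of $C_c^\infty(G)$ in $H^1(G)$. The weak partial derivative \<open>g\<close> below
  is unique, and smallness is required of $f - \varphi$ and of each of the finitely many partial
  derivatives.
\<close>
definition sobolev_H10 :: "'a::euclidean_space set \<Rightarrow> 'a l2 set" where
  "sobolev_H10 G = {f \<in> sobolev_H1 G. \<forall>\<epsilon>>0. \<exists>\<phi>\<in>test_functions G.
     norm (f - to_l2 \<phi>) < \<epsilon> \<and>
     (\<forall>b\<in>Basis. \<exists>g. weak_partial G b f g \<and> norm (g - to_l2 (dir_deriv b \<phi>)) < \<epsilon>)}"

text \<open>
  The graph of the Dirichlet Laplacian, an unbounded operator in $L^2(G)$ with domain
  $\{f \in H^1_0(G) : \Delta f \in L^2(G)\}$, where $\Delta f$ is taken in the distributional sense.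
\<close>
definition dirichlet_laplacian :: "'a::euclidean_space set \<Rightarrow> ('a l2 \<times> 'a l2) set" where
  "dirichlet_laplacian G = {(f, g). f \<in> sobolev_H10 G \<and> g \<in> L2_on G \<and>
     (\<forall>\<phi>\<in>test_functions G.
        (LINT x|lebesgue. rep_l2 f x * laplacian \<phi> x) = (LINT x|lebesgue. rep_l2 g x * \<phi> x))}"

subsection \<open>The unitary group and Duhamel's formula\<close>

text \<open>
  Operators on a complex subspace \<open>H\<close> are total functions of which only the restriction to \<open>H\<close>
  matters.
\<close>
definition unitary_on :: "'a::euclidean_space l2 set \<Rightarrow> ('a l2 \<Rightarrow> 'a l2) \<Rightarrow> bool" where
  "unitary_on H V \<longleftrightarrow> bij_betw V H H \<and>
     (\<forall>f\<in>H. \<forall>g\<in>H. V (f + g) = V f + V g) \<and>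
     (\<forall>c. \<forall>f\<in>H. V (c *\<^sub>C f) = c *\<^sub>C V f) \<and>
     (\<forall>f\<in>H. norm (V f) = norm f)"

definition unitary_group_on :: "'a::euclidean_space l2 set \<Rightarrow> (real \<Rightarrow> 'a l2 \<Rightarrow> 'a l2) \<Rightarrow> bool" where
  "unitary_group_on H U \<longleftrightarrow> (\<forall>t. unitary_on H (U t)) \<and>
     (\<forall>f\<in>H. U 0 f = f) \<and>
     (\<forall>s t. \<forall>f\<in>H. U (s + t) f = U s (U t f)) \<and>
     (\<forall>f\<in>H. continuous_on UNIV (\<lambda>t. U t f))"

definition generator_on ::
  "'a::euclidean_space l2 set \<Rightarrow> (real \<Rightarrow> 'a l2 \<Rightarrow> 'a l2) \<Rightarrow> ('a l2 \<times> 'a l2) set" where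
  "generator_on H U =
     {(f, g). f \<in> H \<and> g \<in> H \<and> ((\<lambda>t. U t f) has_vector_derivative g) (at 0)}"

text \<open>
  \<open>U\<close> is the unitary group $(e^{it\Delta})_{t \in \mathbb{R}}$ on $L^2(G)$, characterised by its
  generator $i\Delta$ (equality of graphs, hence of domains).
\<close>
definition dirichlet_schroedinger_group ::
  "'a::euclidean_space set \<Rightarrow> (real \<Rightarrow> 'a l2 \<Rightarrow> 'a l2) \<Rightarrow> bool" where
  "dirichlet_schroedinger_group G U \<longleftrightarrow> unitary_group_on (L2_on G) U \<and>
     generator_on (L2_on G) U = {(f, \<i> *\<^sub>C g) | f g. (f, g) \<in> dirichlet_laplacian G}"

text \<open>
  $\mathbf{1}_{G_0} u(s, \cdot)$. For almost every \<open>s\<close> this slice is square integrable and its class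
  does not depend on the representative of \<open>u\<close>; the exceptional \<open>s\<close> contribute zero.
\<close>
definition control_slice ::
  "'a::euclidean_space set \<Rightarrow> (real \<times> 'a) l2 \<Rightarrow> real \<Rightarrow> 'a l2" where
  "control_slice G0 u s = to_l2 (\<lambda>x. indicat_real G0 x *\<^sub>R rep_l2 u (s, x))"

text \<open>
  $y(t) = e^{it\xi\Delta} y_0 + \int_0^t e^{i(t-s)\xi\Delta}\,\mathbf{1}_{G_0} u(s, \cdot)\,ds$
  with the Bochner integral of the $L^2$-valued integrand. The integral is taken with respect
  to the completed measure because \<open>u\<close> is only Lebesgue measurable.
\<close>
definition schroedinger_solution ::
  "(real \<Rightarrow> 'a::euclidean_space l2 \<Rightarrow> 'a l2) \<Rightarrow> 'a set \<Rightarrow> real \<Rightarrow> 'a l2 \<Rightarrow> (real \<times> 'a) l2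
    \<Rightarrow> real \<Rightarrow> 'a l2" where
  "schroedinger_solution U G0 \<xi> y0 u t =
     U (t * \<xi>) y0 + (LINT s:{0..t}|lebesgue. U ((t - s) * \<xi>) (control_slice G0 u s))"

end

theory Submission
  imports Defs "HOL-Complex_Analysis.Conformal_Mappings" "HOL-Probability.Distributions"
begin

text \<open>
  Let $\mathcal{A}$ be the set of parameters. Test the equation $y(T) = 0$ against a vector and move the
  unitary operators to the other side: $\xi \in \mathcal{A}$ means
  $\langle x, y_0\rangle + \int_0^T \langle e^{is\xi\Delta}x, u(s)\rangle\,ds = 0$ for all
  \<open>x\<close> in $L^2(G)$. If \<open>x\<close> is an eigenfunction of
  $\Delta$ that is not orthogonal to $y_0$, the integral is an entire function of
  $\xi$ which tends to 0 at real infinity by the Riemann--Lebesgue lemma because the eigenvalue is not 0,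
  so it takes the value $-\langle x, y_0\rangle \neq 0$ only finitely often on the real line.

  The proof follows this idea without the spectral decomposition. Two properties of an eigenfunction
  are needed, and each has a substitute for a general unitary group. Entire dependence on $\xi$ is
  obtained by averaging the orbit of a vector over time with a Gaussian weight, since
  a shift of time then acts on the Gaussian, which is entire. Decay is
  obtained for vectors of the form $U(r)x - x$: shifting the orbit by \<open>r\<close> amounts to shifting the time
  \<open>s\<close> by $r/\xi$, and translations are continuous in $L^1$ (\<open>L1_translation_continuous\<close>).
  Both are combined in \<open>annihilating_parameters_finite\<close>, which requires
  that the initial value is moved by the group.

  The Dirichlet Laplacian thus enters only through \<open>dirichlet_laplacian_injective\<close>: it has no kernel on a
  bounded set, by the Poincare inequality for test functions. Hence no nonzero vector is fixed by the
  group (\<open>schroedinger_group_moves\<close>).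
\<close>

section \<open>Continuity of translations in L1\<close>

lemma distr_lebesgue_shift: "distr lebesgue lebesgue ((+) a) = (lebesgue :: real measure)"
  using lebesgue_real_affine[of 1 a] by (simp add: density_1)

lemma measurable_lebesgue_shift [measurable]: "(+) (a::real) \<in> lebesgue \<rightarrow>\<^sub>M lebesgue"
  using lebesgue_affine_measurable[of "\<lambda>_::real. 1" a] by simp

lemma integrable_lebesgue_shift:
  fixes f :: "real \<Rightarrow> 'b::{banach, second_countable_topology}"
  assumes "integrable lebesgue f"
  shows "integrable lebesgue (\<lambda>x. f (a + x))"
  using integrable_distr[of "(+) a" lebesgue lebesgue f] assms
  by (simp add: distr_lebesgue_shift)

lemma integral_lebesgue_shift:
  fixes f :: "real \<Rightarrow> 'b::{banach, second_countable_topology}"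
  assumes "f \<in> borel_measurable lebesgue"
  shows "(LINT x|lebesgue. f (a + x)) = (LINT x|lebesgue. f x)"
  using integral_distr[OF measurable_lebesgue_shift assms, of a] by (simp add: distr_lebesgue_shift)

text \<open>
  Translations are isometries of $L^1$, so continuity of the translates passes to $L^1$ limits by
  an $\varepsilon/3$ argument. The hypotheses are those of the limit case of
  \<open>integrable_induct\<close>.
\<close>
lemma L1_translation_closed:
  fixes f :: "real \<Rightarrow> 'b::{banach, second_countable_topology}"
  assumes s: "\<And>i::nat. integrable lebesgue (s i)"
    and trans: "\<And>i e. 0 < e \<Longrightarrow> \<exists>d>0. \<forall>h. \<bar>h\<bar> < d \<longrightarrow> (LINT x|lebesgue. norm (s i (h + x) - s i x)) < e"
    and f: "integrable lebesgue f"
    and lim: "\<And>x. (\<lambda>i. s i x) \<longlonglongrightarrow> f x"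
    and dom: "\<And>i x. norm (s i x) \<le> 2 * norm (f x)"
    and e: "0 < (e::real)"
  shows "\<exists>d>0. \<forall>h. \<bar>h\<bar> < d \<longrightarrow> (LINT x|lebesgue. norm (f (h + x) - f x)) < e"
proof -
  note [measurable] = borel_measurable_integrable[OF f] borel_measurable_integrable[OF s]
  have "(\<lambda>i. LINT x|lebesgue. norm (s i x - f x)) \<longlonglongrightarrow> (LINT x|(lebesgue :: real measure). 0)"
  proof (rule integral_dominated_convergence)
    show "integrable lebesgue (\<lambda>x. 3 * norm (f x))" using f by simp
    show "AE x in lebesgue. (\<lambda>i. norm (s i x - f x)) \<longlonglongrightarrow> 0"
      using lim by (simp add: tendsto_norm_zero_iff LIM_zero_iff)
    show "AE x in lebesgue. norm (norm (s i x - f x)) \<le> 3 * norm (f x)" for i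
    proof (rule AE_I2)
      fix x show "norm (norm (s i x - f x)) \<le> 3 * norm (f x)"
        using norm_triangle_ineq4[of "s i x" "f x"] dom[of i x] by simp
    qed
  qed measurable
  then have "\<forall>\<^sub>F i in sequentially. (LINT x|lebesgue. norm (s i x - f x)) < e / 3"
    using e by (intro order_tendstoD(2)) auto
  then obtain i where i: "(LINT x|lebesgue. norm (s i x - f x)) < e / 3"
    by (auto simp: eventually_sequentially)
  obtain d where d: "d > 0" "\<And>h. \<bar>h\<bar> < d \<Longrightarrow> (LINT x|lebesgue. norm (s i (h + x) - s i x)) < e / 3"
    using trans[of "e / 3" i] e by auto
  have "(LINT x|lebesgue. norm (f (h + x) - f x)) < e" if h: "\<bar>h\<bar> < d" for h
  proof -
    have int: "integrable lebesgue (\<lambda>x. norm (s i x - f x))" using s f by auto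
    have int2: "integrable lebesgue (\<lambda>x. norm (s i (h + x) - f (h + x)))"
      using integrable_lebesgue_shift[OF int] .
    have int3: "integrable lebesgue (\<lambda>x. norm (s i (h + x) - s i x))"
      using integrable_lebesgue_shift[OF s] s by auto
    have "(LINT x|lebesgue. norm (f (h + x) - f x))
      \<le> (LINT x|lebesgue. norm (s i (h + x) - f (h + x)) + norm (s i (h + x) - s i x) + norm (s i x - f x))"
    proof (intro integral_mono)
      fix x
      have "f (h + x) - f x = - (s i (h + x) - f (h + x)) + (s i (h + x) - s i x) + (s i x - f x)"
        by simp
      then show "norm (f (h + x) - f x)
        \<le> norm (s i (h + x) - f (h + x)) + norm (s i (h + x) - s i x) + norm (s i x - f x)"
        by (metis norm_minus_cancel norm_triangle_mono norm_triangle_ineq order_refl)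
    qed (use int int2 int3 integrable_lebesgue_shift[OF f] f in auto)
    also have "\<dots> = 2 * (LINT x|lebesgue. norm (s i x - f x)) + (LINT x|lebesgue. norm (s i (h + x) - s i x))"
      using int int2 int3
        integral_lebesgue_shift[OF borel_measurable_integrable[OF int], of h] by simp
    also have "\<dots> < e" using i d(2)[OF h] by simp
    finally show ?thesis .
  qed
  with d(1) show ?thesis by blast
qed

text \<open>
  Squeeze \<open>A\<close> between a compact \<open>K\<close> and an open \<open>V\<close> with \<open>V - K\<close> of small measure. A shift by
  less than the distance from \<open>K\<close> to the complement of \<open>V\<close> moves points of \<open>K\<close> only inside \<open>V\<close>,
  so the indicator can change at \<open>x\<close> only if \<open>x\<close> or its translate lies in \<open>V - K\<close>.
\<close>
lemma L1_translation_indicator: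
  fixes A :: "real set" and c :: "'b::{banach, second_countable_topology}"
  assumes A: "A \<in> sets lebesgue" "bounded A" and e: "0 < (e::real)"
  shows "\<exists>d>0. \<forall>h. \<bar>h\<bar> < d \<longrightarrow>
    (LINT x|lebesgue. norm (indicator A (h + x) *\<^sub>R c - indicator A x *\<^sub>R c)) < e"
proof -
  define q where "q = e / (norm c + 1)"
  define \<epsilon> where "\<epsilon> = q / 4"
  have \<epsilon>: "\<epsilon> > 0" "4 * \<epsilon> * norm c < e"
  proof -
    show "\<epsilon> > 0" using e by (auto simp: \<epsilon>_def q_def intro!: divide_pos_pos add_nonneg_pos)
    have "norm c / (norm c + 1) < 1" by (simp add: add_nonneg_pos)
    then have "e * (norm c / (norm c + 1)) < e * 1" using e by (intro mult_strict_left_mono) auto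
    then show "4 * \<epsilon> * norm c < e" by (simp add: \<epsilon>_def q_def[symmetric]) (simp add: q_def)
  qed
  obtain V where V: "open V" "A \<subseteq> V" "V - A \<in> lmeasurable" "emeasure lebesgue (V - A) < ennreal \<epsilon>"
    using sets_lebesgue_outer_open[OF A(1) \<epsilon>(1)] .
  obtain K where K: "closed K" "K \<subseteq> A" "A - K \<in> lmeasurable" "emeasure lebesgue (A - K) < ennreal \<epsilon>"
    using sets_lebesgue_inner_closed[OF A(1) \<epsilon>(1)] .
  have "compact K" using K A(2) bounded_subset compact_eq_bounded_closed by blast
  moreover have "closed (- V)" "K \<inter> - V = {}" using V K by auto
  ultimately obtain d where d: "d > 0" "\<And>x y. x \<in> K \<Longrightarrow> y \<notin> V \<Longrightarrow> d \<le> dist x y"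
    using separate_compact_closed[of K "- V"] by auto
  let ?D = "V - K"
  have D_eq: "?D = (V - A) \<union> (A - K)" using V K by auto
  have D: "?D \<in> lmeasurable" unfolding D_eq using V(3) K(3) by blast
  have Dm: "measure lebesgue ?D \<le> 2 * \<epsilon>"
  proof -
    have "measure lebesgue (V - A) \<le> \<epsilon>" "measure lebesgue (A - K) \<le> \<epsilon>"
      unfolding measure_def using V(4) K(4) \<epsilon>(1) by (auto intro!: enn2real_leI)
    then show ?thesis unfolding D_eq using measure_Un_le[of "V - A" lebesgue "A - K"] V(3) K(3) by auto
  qed
  have intD: "integrable lebesgue (indicat_real ?D)"
    using D by (simp add: lmeasurable_iff_integrable)
  have "(LINT x|lebesgue. norm (indicator A (h + x) *\<^sub>R c - indicator A x *\<^sub>R c)) < e" if h: "\<bar>h\<bar> < d" for h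
  proof -
    have "(LINT x|lebesgue. norm (indicator A (h + x) *\<^sub>R c - indicator A x *\<^sub>R c))
       \<le> (LINT x|lebesgue. (indicat_real ?D (h + x) + indicat_real ?D x) * norm c)"
    proof (rule integral_mono_AE')
      show "integrable lebesgue (\<lambda>x. (indicat_real ?D (h + x) + indicat_real ?D x) * norm c)"
        using integrable_lebesgue_shift[OF intD] intD by (intro integrable_mult_left integrable_add) auto
      have "norm (indicator A (h + x) *\<^sub>R c - indicator A x *\<^sub>R c)
          \<le> (indicat_real ?D (h + x) + indicat_real ?D x) * norm c" for x
      proof -
        have "x \<in> V" if "h + x \<in> K" using d(2)[OF that, of x] h by (auto simp: dist_real_def)
        moreover have "h + x \<in> V" if "x \<in> K" using d(2)[OF that, of "h + x"] h by (auto simp: dist_real_def)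
        ultimately show ?thesis using V(2) K(2)
          by (cases "h + x \<in> A"; cases "x \<in> A"; cases "h + x \<in> K"; cases "x \<in> K")
             (auto simp: indicator_def)
      qed
      then show "AE x in lebesgue. norm (indicator A (h + x) *\<^sub>R c - indicator A x *\<^sub>R c)
          \<le> (indicat_real ?D (h + x) + indicat_real ?D x) * norm c" by simp
    qed simp
    also have "\<dots> = 2 * measure lebesgue ?D * norm c"
      using integrable_lebesgue_shift[OF intD, of h] intD
        integral_lebesgue_shift[OF borel_measurable_integrable[OF intD], of h] by simp
    also have "\<dots> \<le> 2 * (2 * \<epsilon>) * norm c" using Dm by (intro mult_right_mono) auto
    also have "\<dots> < e" using \<epsilon>(2) by simp
    finally show ?thesis .
  qed
  with d(1) show ?thesis by blast
qed

text \<open>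
  This is the substitute for the Riemann--Lebesgue lemma: a bounded orbit that is shifted in
  its argument can be compared with a translate of the integrand, as in \<open>orbit_difference_bound\<close> below.
\<close>
theorem L1_translation_continuous:
  fixes f :: "real \<Rightarrow> 'b::{banach, second_countable_topology}"
  assumes "integrable lebesgue f" "0 < (e::real)"
  shows "\<exists>d>0. \<forall>h. \<bar>h\<bar> < d \<longrightarrow> (LINT x|lebesgue. norm (f (h + x) - f x)) < e"
  using assms
proof (induction arbitrary: e rule: integrable_induct)
  case (base A c)
  show ?case
  proof (rule L1_translation_closed)
    \<comment> \<open>The inner approximation needs a compact set, hence the truncation to bounded sets.\<close>
    let ?A = "\<lambda>i::nat. A \<inter> {- real i .. real i}"
    have sets: "?A i \<in> sets lebesgue" for i using base(1) by auto
    have "emeasure lebesgue (?A i) < \<infinity>" for i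
      by (rule le_less_trans[OF emeasure_mono base(2)]) (use base(1) in auto)
    then show "integrable lebesgue (\<lambda>x. indicat_real (?A i) x *\<^sub>R c)" for i
      using sets by (intro integrable_scaleR_left integrable_real_indicator) auto
    show "\<exists>d>0. \<forall>h. \<bar>h\<bar> < d \<longrightarrow>
       (LINT x|lebesgue. norm (indicat_real (?A i) (h + x) *\<^sub>R c - indicat_real (?A i) x *\<^sub>R c)) < e"
      if "0 < e" for i e
      using sets that by (intro L1_translation_indicator) (auto intro: bounded_subset[of "{- real i .. real i}"])
    show "integrable lebesgue (\<lambda>x. indicat_real A x *\<^sub>R c)"
      using base by (intro integrable_scaleR_left integrable_real_indicator) auto
    show "(\<lambda>i. indicat_real (?A i) x *\<^sub>R c) \<longlonglongrightarrow> indicat_real A x *\<^sub>R c" for x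
    proof (rule tendsto_eventually)
      obtain N where N: "\<bar>x\<bar> \<le> real N" using real_arch_simple by blast
      show "\<forall>\<^sub>F i in sequentially. indicat_real (?A i) x *\<^sub>R c = indicat_real A x *\<^sub>R c"
        using eventually_ge_at_top[of N]
      proof eventually_elim
        case (elim i)
        then have "\<bar>x\<bar> \<le> real i" using N by linarith
        then show ?case by (auto simp: indicator_def)
      qed
    qed
    show "norm (indicat_real (?A i) x *\<^sub>R c) \<le> 2 * norm (indicat_real A x *\<^sub>R c)" for i x
      by (auto simp: indicator_def)
  qed (rule base(3))
next
  case (add f g)
  obtain d1 where d1: "d1 > 0" "\<And>h. \<bar>h\<bar> < d1 \<Longrightarrow> (LINT x|lebesgue. norm (f (h + x) - f x)) < e / 2"
    using add.IH(1)[of "e / 2"] add.prems by auto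
  obtain d2 where d2: "d2 > 0" "\<And>h. \<bar>h\<bar> < d2 \<Longrightarrow> (LINT x|lebesgue. norm (g (h + x) - g x)) < e / 2"
    using add.IH(2)[of "e / 2"] add.prems by auto
  have "(LINT x|lebesgue. norm ((f (h + x) + g (h + x)) - (f x + g x))) < e" if h: "\<bar>h\<bar> < min d1 d2" for h
  proof -
    have i: "integrable lebesgue (\<lambda>x. f (h + x) - f x)" "integrable lebesgue (\<lambda>x. g (h + x) - g x)"
      using integrable_lebesgue_shift[of f h] integrable_lebesgue_shift[of g h] add.hyps by auto
    have "(LINT x|lebesgue. norm ((f (h + x) + g (h + x)) - (f x + g x)))
      \<le> (LINT x|lebesgue. norm (f (h + x) - f x) + norm (g (h + x) - g x))"
    proof (rule integral_mono)
      show "norm ((f (h + x) + g (h + x)) - (f x + g x)) \<le> norm (f (h + x) - f x) + norm (g (h + x) - g x)" for x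
        using norm_triangle_ineq[of "f (h + x) - f x" "g (h + x) - g x"] by (simp add: algebra_simps)
      have "integrable lebesgue (\<lambda>x. norm ((f (h + x) - f x) + (g (h + x) - g x)))"
        using i by auto
      then show "integrable lebesgue (\<lambda>x. norm ((f (h + x) + g (h + x)) - (f x + g x)))"
        by (simp add: algebra_simps)
    qed (use i in auto)
    also have "\<dots> = (LINT x|lebesgue. norm (f (h + x) - f x)) + (LINT x|lebesgue. norm (g (h + x) - g x))"
      using i by simp
    also have "\<dots> < e" using d1(2)[of h] d2(2)[of h] h by simp
    finally show ?thesis .
  qed
  with d1(1) d2(1) show ?case by (intro exI[of _ "min d1 d2"]) auto
next
  case (lim f s)
  show ?case
    by (rule L1_translation_closed[of s]) (use lim in auto)
qed

section \<open>Holomorphic parameter integrals and Gaussian averages\<close>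

lemma sigma_finite_lebesgue: "sigma_finite_measure (lebesgue :: 'a::euclidean_space measure)"
proof
  show "\<exists>A::'a set set. countable A \<and> A \<subseteq> sets lebesgue \<and> \<Union> A = space lebesgue \<and>
    (\<forall>a\<in>A. emeasure lebesgue a \<noteq> \<infinity>)"
  proof (intro exI[of _ "range (\<lambda>n. ball 0 (real n))"] conjI)
    show "\<Union> (range (\<lambda>n. ball 0 (real n))) = space (lebesgue :: 'a measure)"
      by (auto simp: reals_Archimedean2)
    show "\<forall>a\<in>range (\<lambda>n. ball (0::'a) (real n)). emeasure lebesgue a \<noteq> \<infinity>"
      using emeasure_bounded_finite[OF bounded_ball, of "0::'a"] by (auto simp: less_top)
  qed auto
qed

text \<open>
  On a slightly larger disc the dominating function controls the integrand, and the Cauchy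
  inequality turns this into a bound on the derivative, hence on all difference quotients. So one
  may differentiate under the integral by dominated convergence.
\<close>
lemma holomorphic_on_integral:
  fixes F :: "complex \<Rightarrow> 'a \<Rightarrow> complex"
  assumes hol: "\<And>x. x \<in> space M \<Longrightarrow> (\<lambda>z. F z x) holomorphic_on UNIV"
    and meas: "\<And>z. F z \<in> borel_measurable M"
    and bound: "\<And>R. \<exists>B. integrable M B \<and> (\<forall>z x. norm z \<le> R \<longrightarrow> x \<in> space M \<longrightarrow> norm (F z x) \<le> B x)"
  shows "(\<lambda>z. \<integral>x. F z x \<partial>M) holomorphic_on UNIV"
proof -
  note [measurable] = meas
  have int: "integrable M (F z)" for z
  proof -
    obtain B where B: "integrable M B" "\<And>x. x \<in> space M \<Longrightarrow> norm (F z x) \<le> B x"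
      using bound[of "norm z"] by auto
    show ?thesis
      by (rule Bochner_Integration.integrable_bound[OF B(1) meas])
         (use B(2) in \<open>auto intro: order_trans[OF _ abs_ge_self]\<close>)
  qed
  have "(\<lambda>z. \<integral>x. F z x \<partial>M) field_differentiable at z0" for z0
  proof -
    \<comment> \<open>Points \<open>v\<close> at distance at most 1 from \<open>z0\<close> are used, and Cauchy circles of radius 1 around them.\<close>
    define R where "R = norm z0 + 2"
    obtain B where B: "integrable M B" "\<And>z x. norm z \<le> R \<Longrightarrow> x \<in> space M \<Longrightarrow> norm (F z x) \<le> B x"
      using bound[of R] by auto
    define D where "D x = deriv (\<lambda>z. F z x) z0" for x
    have deriv: "((\<lambda>z. F z x) has_field_derivative D x) (at z0)" if "x \<in> space M" for x
      unfolding D_def using holomorphic_derivI[OF hol[OF that] open_UNIV, of z0] by simp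
    have quot: "norm ((F w x - F z0 x) / (w - z0)) \<le> B x" if x: "x \<in> space M" and w: "w \<in> cball z0 1" for x w
    proof -
      have d: "norm (deriv (\<lambda>z. F z x) v) \<le> B x" if v: "v \<in> cball z0 1" for v
      proof -
        have "norm ((deriv ^^ 1) (\<lambda>z. F z x) v) \<le> fact 1 * B x / 1 ^ 1"
        proof (rule Cauchy_inequality)
          show "(\<lambda>z. F z x) holomorphic_on ball v 1"
            using hol[OF x] by (rule holomorphic_on_subset) simp
          show "continuous_on (cball v 1) (\<lambda>z. F z x)"
            using holomorphic_on_imp_continuous_on[OF hol[OF x]] by (rule continuous_on_subset) simp
          show "norm (F y x) \<le> B x" if "norm (v - y) = 1" for y
          proof (rule B(2)[OF _ x])
            have "norm y \<le> norm z0 + norm (v - z0) + norm (v - y)"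
              by norm
            then show "norm y \<le> R" using v that by (simp add: R_def dist_norm norm_minus_commute)
          qed
        qed simp
        then show ?thesis by simp
      qed
      have "norm (F w x - F z0 x) \<le> B x * norm (w - z0)"
      proof (rule field_differentiable_bound[of "cball z0 1"])
        show "((\<lambda>z. F z x) has_field_derivative deriv (\<lambda>z. F z x) v) (at v within cball z0 1)" for v
          using holomorphic_derivI[OF hol[OF x] open_UNIV, of v] by (auto intro: DERIV_subset)
      qed (use d w in auto)
      moreover have "0 \<le> B x"
        using d[of z0] by (auto intro: order_trans[OF norm_ge_zero])
      ultimately show ?thesis
        by (cases "w = z0") (auto simp: norm_divide divide_simps)
    qed
    have "((\<lambda>w. ((\<integral>x. F w x \<partial>M) - (\<integral>x. F z0 x \<partial>M)) / (w - z0)) \<longlongrightarrow> (\<integral>x. D x \<partial>M)) (at z0)"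
      unfolding tendsto_at_iff_sequentially
    proof (intro allI impI)
      fix X :: "nat \<Rightarrow> complex"
      assume X: "\<forall>i. X i \<in> UNIV - {z0}" "X \<longlonglongrightarrow> z0"
      \<comment> \<open>\<open>Y\<close> agrees with \<open>X\<close> eventually and stays in the disc where the bound \<open>quot\<close> holds;
        \<open>z0 + 1\<close> is an arbitrary point of that disc other than \<open>z0\<close>.\<close>
      define Y where "Y i = (if X i \<in> cball z0 1 then X i else z0 + 1)" for i
      have evXY: "\<forall>\<^sub>F i in sequentially. X i = Y i"
        using X(2)[THEN tendstoD, of 1] unfolding Y_def by (auto elim!: eventually_mono simp: dist_commute)
      have Y0: "Y \<longlonglongrightarrow> z0" using Lim_transform_eventually[OF X(2) evXY] .
      have Y: "Y i \<in> cball z0 1" "Y i \<noteq> z0" for i using X(1) by (auto simp: Y_def dist_norm)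
      have lim: "(\<lambda>i. (F (Y i) x - F z0 x) / (Y i - z0)) \<longlonglongrightarrow> D x" if "x \<in> space M" for x
      proof -
        have "((\<lambda>w. (F w x - F z0 x) / (w - z0)) \<longlongrightarrow> D x) (at z0)"
          using deriv[OF that] by (simp add: has_field_derivative_iff)
        moreover have "filterlim Y (at z0) sequentially"
          using Y0 Y(2) by (simp add: filterlim_at)
        ultimately show ?thesis by (rule filterlim_compose)
      qed
      have "(\<lambda>i. \<integral>x. (F (Y i) x - F z0 x) / (Y i - z0) \<partial>M) \<longlonglongrightarrow> (\<integral>x. D x \<partial>M)"
      proof (rule integral_dominated_convergence[OF _ _ B(1)])
        show "D \<in> borel_measurable M"
          by (rule borel_measurable_LIMSEQ_metric[OF _ lim]) measurable
      qed (use lim quot Y in auto)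
      then have "(\<lambda>i. ((\<integral>x. F (Y i) x \<partial>M) - (\<integral>x. F z0 x \<partial>M)) / (Y i - z0)) \<longlonglongrightarrow> (\<integral>x. D x \<partial>M)"
        using int by simp
      then show "((\<lambda>w. ((\<integral>x. F w x \<partial>M) - (\<integral>x. F z0 x \<partial>M)) / (w - z0)) \<circ> X) \<longlonglongrightarrow> (\<integral>x. D x \<partial>M)"
        by (rule Lim_transform_eventually) (use evXY in \<open>auto elim!: eventually_mono\<close>)
    qed
    then show ?thesis
      by (auto simp: field_differentiable_def has_field_derivative_iff)
  qed
  then show ?thesis
    by (auto simp: holomorphic_on_def intro: field_differentiable_at_within)
qed

lemma integrable_gaussian:
  assumes "0 < a"
  shows "integrable lborel (\<lambda>t::real. exp (- a * t\<^sup>2))"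
proof -
  have "has_bochner_integral lborel (\<lambda>x::real. exp (- x\<^sup>2) * x ^ (2 * 0)) (sqrt pi)"
    using has_bochner_integral_even_function[OF gaussian_moment_even_pos[where k = 0]] by simp
  then have "integrable lborel (\<lambda>x::real. exp (- x\<^sup>2))"
    by (simp add: has_bochner_integral_iff)
  from lborel_integrable_real_affine[OF this, of "sqrt a" 0] show ?thesis
    using assms by (simp add: power_mult_distrib)
qed

text \<open>
  Narrow Gaussians are an approximate identity: after rescaling, the averages with
  $a = (n+1)^2$ converge to a positive multiple of \<open>f 0\<close>.
\<close>
lemma gaussian_average_nonzero:
  fixes f :: "real \<Rightarrow> real"
  assumes cont: "continuous_on UNIV f" and bdd: "\<And>t. \<bar>f t\<bar> \<le> C" and f0: "f 0 \<noteq> 0"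
  shows "\<exists>a>0. (LBINT t. exp (- a * t\<^sup>2) * f t) \<noteq> 0"
proof -
  let ?n = "\<lambda>n. real (Suc n)"
  have [measurable]: "f \<in> borel_measurable borel"
    using cont by (rule borel_measurable_continuous_onI)
  have g: "integrable lborel (\<lambda>t::real. exp (- 1 * t\<^sup>2))"
    by (rule integrable_gaussian) simp
  have "(\<lambda>n. LBINT t. exp (- 1 * t\<^sup>2) * f (t / ?n n)) \<longlonglongrightarrow> (LBINT t. exp (- 1 * t\<^sup>2) * f 0)"
  proof (rule integral_dominated_convergence)
    show "integrable lborel (\<lambda>t::real. C * exp (- 1 * t\<^sup>2))" using g by simp
    have "(\<lambda>n. t / ?n n) \<longlonglongrightarrow> 0" for t
      using tendsto_mult[OF tendsto_const[of t] LIMSEQ_inverse_real_of_nat] by (simp add: field_simps)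
    then have "(\<lambda>n. f (t / ?n n)) \<longlonglongrightarrow> f 0" for t
      by (rule continuous_on_tendsto_compose[OF cont]) auto
    then show "AE t in lborel. (\<lambda>n. exp (- 1 * t\<^sup>2) * f (t / ?n n)) \<longlonglongrightarrow> exp (- 1 * t\<^sup>2) * f 0"
      by (intro AE_I2 tendsto_mult tendsto_const)
    show "AE t in lborel. norm (exp (- 1 * t\<^sup>2) * f (t / ?n n)) \<le> C * exp (- 1 * t\<^sup>2)" for n
      using bdd by (intro AE_I2) (simp add: abs_mult mult.commute mult_right_mono)
  qed measurable
  moreover have "(LBINT t. exp (- 1 * t\<^sup>2) * f 0) \<noteq> 0"
  proof -
    have "(LBINT t::real. exp (- 1 * t\<^sup>2)) \<noteq> 0"
    proof
      assume "(LBINT t::real. exp (- 1 * t\<^sup>2)) = 0"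
      then have "AE t in (lborel :: real measure). exp (- 1 * t\<^sup>2) = 0"
        using integral_nonneg_eq_0_iff_AE[OF g] by simp
      then show False by (simp add: AE_iff_null null_sets_def)
    qed
    with f0 show ?thesis by simp
  qed
  ultimately have "\<forall>\<^sub>F n in sequentially. (LBINT t. exp (- 1 * t\<^sup>2) * f (t / ?n n)) \<noteq> 0"
    by (rule tendsto_imp_eventually_ne)
  then obtain n where n: "(LBINT t. exp (- 1 * t\<^sup>2) * f (t / ?n n)) \<noteq> 0"
    by (auto simp: eventually_sequentially)
  have "(LBINT t. exp (- 1 * t\<^sup>2) * f (t / ?n n)) = ?n n * (LBINT t. exp (- (?n n)\<^sup>2 * t\<^sup>2) * f t)"
    by (subst lborel_integral_real_affine[where c = "?n n" and t = 0])
       (simp_all add: power_mult_distrib del: of_nat_Suc)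
  with n have "(LBINT t. exp (- (?n n)\<^sup>2 * t\<^sup>2) * f t) \<noteq> 0" by auto
  then show ?thesis by (intro exI[of _ "(?n n)\<^sup>2"]) auto
qed

section \<open>Isometry groups and entire averages of orbits\<close>

text \<open>
  A strongly continuous group of linear isometries of \<open>H\<close>. Only the real structure of \<open>H\<close> is used,
  so that inner products are real numbers; for $L^2(G)$ this is the real part of the Hermitian product.
\<close>
locale isometry_group =
  fixes H :: "'h::{real_inner, banach, second_countable_topology} set"
    and U :: "real \<Rightarrow> 'h \<Rightarrow> 'h"
  assumes diff_mem: "\<And>f g. f \<in> H \<Longrightarrow> g \<in> H \<Longrightarrow> f - g \<in> H"
    and U_mem: "\<And>t f. f \<in> H \<Longrightarrow> U t f \<in> H"
    and U_diff: "\<And>t f g. f \<in> H \<Longrightarrow> g \<in> H \<Longrightarrow> U t (f - g) = U t f - U t g"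
    and U_norm: "\<And>t f. f \<in> H \<Longrightarrow> norm (U t f) = norm f"
    and U_0: "\<And>f. f \<in> H \<Longrightarrow> U 0 f = f"
    and U_add: "\<And>s t f. f \<in> H \<Longrightarrow> U (s + t) f = U s (U t f)"
    and U_cont: "\<And>f. f \<in> H \<Longrightarrow> continuous_on UNIV (\<lambda>t. U t f)"
begin

lemma U_inner:
  assumes "f \<in> H" "g \<in> H"
  shows "inner (U t f) (U t g) = inner f g"
proof -
  have polar: "2 * inner a b = (norm a)\<^sup>2 + (norm b)\<^sup>2 - (norm (a - b))\<^sup>2" for a b :: 'h
    by (simp add: power2_norm_eq_inner inner_diff inner_commute)
  show ?thesis
    using polar[of "U t f" "U t g"] polar[of f g] U_diff[OF assms, of t, symmetric]
      U_norm[OF assms(1), of t] U_norm[OF assms(2), of t] U_norm[OF diff_mem[OF assms], of t]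
    by simp
qed

lemma orbit_measurable [measurable (raw)]:
  assumes "f \<in> H" "g \<in> borel_measurable M"
  shows "(\<lambda>x. U (g x) f) \<in> borel_measurable M"
  using measurable_compose[OF assms(2) borel_measurable_continuous_onI[OF U_cont[OF assms(1)]]] .

lemma inner_orbit_bound:
  assumes "f \<in> H"
  shows "\<bar>inner (U t f) v\<bar> \<le> norm f * norm v"
  using Cauchy_Schwarz_ineq2[of "U t f" v] U_norm[OF assms] by simp

lemma integrable_orbit:
  assumes f: "f \<in> H" and k: "integrable lebesgue k"
  shows "integrable lebesgue (\<lambda>s::real. inner (U (t + s * \<eta>) f) (k s))"
proof (rule Bochner_Integration.integrable_bound)
  show "integrable lebesgue (\<lambda>s. norm f * norm (k s))" using k by simp
  note [measurable] = borel_measurable_integrable[OF k]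
  have [measurable]: "(\<lambda>s::real. s) \<in> borel_measurable lebesgue" by (simp add: measurable_completion)
  show "(\<lambda>s. inner (U (t + s * \<eta>) f) (k s)) \<in> borel_measurable lebesgue"
    using f by measurable
qed (use inner_orbit_bound[OF f] in auto)

text \<open>
  The decay for large $|\eta|$. Moving along the orbit by \<open>r\<close> is the same as shifting the time \<open>s\<close> by
  $r/\eta$, which is a small shift of \<open>k\<close>. Vectors of the form $U(r)x - x$ are orthogonal to the
  vectors fixed by the group, for which there is no decay. The bound is uniform in \<open>t\<close>, so it
  survives averaging over \<open>t\<close>.
\<close>
lemma orbit_difference_bound:
  assumes x: "x \<in> H" and k: "integrable lebesgue k" and \<eta>: "\<eta> \<noteq> 0"
  shows "\<bar>LINT s|lebesgue. inner (U (t + s * \<eta>) (U r x - x)) (k s)\<bar>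
    \<le> norm x * (LINT s|lebesgue. norm (k (- r / \<eta> + s) - k s))"
proof -
  let ?h = "- r / \<eta>"
  have w: "inner (U (t + s * \<eta>) (U r x - x)) (k s)
      = inner (U (t + r + s * \<eta>) x) (k s) - inner (U (t + s * \<eta>) x) (k s)" for s
    using U_diff[OF U_mem[OF x, of r] x] U_add[OF x, of "t + s * \<eta>" r, symmetric]
    by (simp add: inner_diff_left ac_simps)
  have kh: "integrable lebesgue (\<lambda>s. k (?h + s))" by (rule integrable_lebesgue_shift[OF k])
  have "(LINT s|lebesgue. inner (U (t + r + s * \<eta>) x) (k s))
      = (LINT s|lebesgue. inner (U (t + r + (?h + s) * \<eta>) x) (k (?h + s)))"
    using integral_lebesgue_shift[OF borel_measurable_integrable[OF
        integrable_orbit[OF x k, where t = "t + r" and \<eta> = \<eta>]], where a = ?h]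
    by (rule sym)
  also have "\<dots> = (LINT s|lebesgue. inner (U (t + s * \<eta>) x) (k (?h + s)))"
    using \<eta> by (simp add: left_diff_distrib)
  finally have "(LINT s|lebesgue. inner (U (t + s * \<eta>) (U r x - x)) (k s))
      = (LINT s|lebesgue. inner (U (t + s * \<eta>) x) (k (?h + s) - k s))"
    unfolding w inner_diff_right using integrable_orbit[OF x] k kh by simp
  also have "\<bar>\<dots>\<bar> \<le> (LINT s|lebesgue. \<bar>inner (U (t + s * \<eta>) x) (k (?h + s) - k s)\<bar>)"
    by (rule integral_abs_bound)
  also have "\<dots> \<le> (LINT s|lebesgue. norm x * norm (k (?h + s) - k s))"
  proof (rule integral_mono)
    show "integrable lebesgue (\<lambda>s. \<bar>inner (U (t + s * \<eta>) x) (k (?h + s) - k s)\<bar>)"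
      using k kh by (intro integrable_abs integrable_orbit[OF x] Bochner_Integration.integrable_diff)
    show "integrable lebesgue (\<lambda>s. norm x * norm (k (?h + s) - k s))"
      using k kh by simp
  qed (rule inner_orbit_bound[OF x])
  finally show ?thesis by simp
qed

text \<open>
  With $z = p + iq$ the exponent has real part $-a((t-sp)^2 - s^2q^2)$, and
  $(t-sp)^2 \ge t^2/2 - s^2p^2$. Hence the Gaussian is bounded by an integrable function of \<open>t\<close>,
  uniformly for \<open>z\<close> in a disc and \<open>s\<close> in a bounded interval.
\<close>
lemma gaussian_bound:
  fixes t s T R a :: real and z :: complex
  assumes "norm z \<le> R" "\<bar>s\<bar> \<le> T" "a > 0"
  shows "norm (exp (- of_real a * (of_real t - of_real s * z)\<^sup>2))
    \<le> exp (- (a / 2) * t\<^sup>2) * exp (a * (T * R)\<^sup>2)"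
proof -
  have "(s * norm z)\<^sup>2 \<le> (T * R)\<^sup>2"
  proof -
    have "\<bar>s\<bar> * norm z \<le> T * R" using assms by (intro mult_mono) auto
    from power_mono[OF this, of 2] show ?thesis by (simp add: power_mult_distrib)
  qed
  moreover have "(norm z)\<^sup>2 = (Re z)\<^sup>2 + (Im z)\<^sup>2" by (rule cmod_power2)
  moreover have "0 \<le> (t - 2 * s * Re z)\<^sup>2" by simp
  ultimately have "t\<^sup>2 / 2 - (T * R)\<^sup>2 \<le> Re ((of_real t - of_real s * z)\<^sup>2)"
    by (simp add: power2_eq_square algebra_simps)
  then have "a * (t\<^sup>2 / 2 - (T * R)\<^sup>2) \<le> a * Re ((of_real t - of_real s * z)\<^sup>2)"
    using assms(3) by (intro mult_left_mono) auto
  then show ?thesis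
    unfolding norm_exp_eq_Re exp_add[symmetric] by (simp add: algebra_simps)
qed

text \<open>
  For a vector \<open>w\<close>, consider the average of $\int \langle U(t + s\eta)w, k(s)\rangle\,ds$ over \<open>t\<close> with
  respect to a Gaussian. Substituting $t \mapsto t - s\eta$ moves $\eta$ into the Gaussian, so that the
  average becomes the restriction to the real line of the entire function
  $h(z) = \int\int e^{-a(t-sz)^2} \langle U(t)w, k(s)\rangle\,dt\,ds$; the bounded support of \<open>k\<close> makes
  this converge. If $\eta$ belongs to the set in question, then $h(\eta) = -c$ with
  $c = \int e^{-at^2}\langle U(t)w, y\rangle\,dt$.

  Take $w = U(r)y - y$. Then $h(\eta) \to 0$ as $|\eta| \to \infty$ along the reals, by
  \<open>orbit_difference_bound\<close> and \<open>L1_translation_continuous\<close>. Moreover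
  $2\langle w, y\rangle = -\|U(r)y - y\|^2 \neq 0$, so $c \neq 0$ for a narrow Gaussian. The decay
  confines the set to a bounded interval; if it were infinite, then $h = -c$ everywhere by the
  identity theorem, against the decay.
\<close>
theorem annihilating_parameters_finite:
  fixes k :: "real \<Rightarrow> 'h"
  assumes k: "integrable lebesgue k" and supp: "\<And>s. \<bar>s\<bar> > T \<Longrightarrow> k s = 0"
    and y: "y \<in> H" "U r y \<noteq> y"
  shows "finite {\<eta>. \<forall>x\<in>H. inner x y + (LINT s|lebesgue. inner (U (s * \<eta>) x) (k s)) = 0}"
proof -
  let ?A = "{\<eta>. \<forall>x\<in>H. inner x y + (LINT s|lebesgue. inner (U (s * \<eta>) x) (k s)) = 0}"
  define w where "w = U r y - y"
  have w: "w \<in> H" using y U_mem diff_mem by (simp add: w_def)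
  have wy: "inner (U 0 w) y \<noteq> 0"
  proof
    assume "inner (U 0 w) y = 0"
    then have "inner (U r y) y = inner y y" using U_0[OF w] by (simp add: w_def inner_diff_left)
    moreover have "inner (U r y) (U r y) = inner y y" using U_inner y by simp
    ultimately have "inner (U r y - y) (U r y - y) = 0"
      by (simp add: inner_diff inner_commute)
    with y(2) show False by simp
  qed
  have "continuous_on UNIV (\<lambda>t. inner (U t w) y)"
    by (intro continuous_on_inner U_cont[OF w] continuous_on_const)
  then obtain a where a: "a > 0" and c: "(LBINT t. exp (- a * t\<^sup>2) * inner (U t w) y) \<noteq> 0"
    using gaussian_average_nonzero[of "\<lambda>t. inner (U t w) y" "norm w * norm y"]
      inner_orbit_bound[OF w] wy by blast
  define c where "c = (LBINT t. exp (- a * t\<^sup>2) * inner (U t w) y)"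
  define I where "I = (LBINT t::real. exp (- a * t\<^sup>2))"
  interpret lebesgue: sigma_finite_measure "lebesgue :: real measure" by (rule sigma_finite_lebesgue)
  interpret P: pair_sigma_finite "lborel :: real measure" "lebesgue :: real measure" ..
  let ?P = "lborel \<Otimes>\<^sub>M (lebesgue :: real measure) :: (real \<times> real) measure"
  have [measurable]: "(\<lambda>s::real. s) \<in> borel_measurable lebesgue" by (simp add: measurable_completion)
  note [measurable] = borel_measurable_integrable[OF k] w
  \<comment> \<open>The dominating functions on the product space; \<open>b\<close> is \<open>a / 2\<close> for \<open>F\<close> and \<open>a\<close> after the shift.\<close>
  have dom: "integrable ?P (\<lambda>(t, s). exp (- b * t\<^sup>2) * (C * norm (k s)))" if "b > 0" for b C
  proof (rule P.Fubini_integrable)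
    show "integrable lborel (\<lambda>t. LINT s|lebesgue. norm (case (t, s) of (t, s) \<Rightarrow> exp (- b * t\<^sup>2) * (C * norm (k s))))"
      using integrable_gaussian[OF that] by (simp add: abs_mult)
    show "AE t in lborel. integrable lebesgue (\<lambda>s. case (t, s) of (t, s) \<Rightarrow> exp (- b * t\<^sup>2) * (C * norm (k s)))"
      using k by simp
  qed measurable
  define F where "F z = (\<lambda>(t, s). exp (- of_real a * (of_real t - of_real s * z)\<^sup>2)
      * of_real (inner (U t w) (k s)))" for z :: complex
  have F_meas: "F z \<in> borel_measurable ?P" for z
    unfolding F_def by measurable
  have F_bound: "norm (F z (t, s)) \<le> exp (- (a / 2) * t\<^sup>2) * ((exp (a * (T * R)\<^sup>2) * norm w) * norm (k s))"
    if "norm z \<le> R" for R z t s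
  proof (cases "\<bar>s\<bar> > T")
    case False
    then have "norm (exp (- of_real a * (of_real t - of_real s * z)\<^sup>2))
      \<le> exp (- (a / 2) * t\<^sup>2) * exp (a * (T * R)\<^sup>2)"
      using gaussian_bound[OF that _ a] by simp
    from mult_mono[OF this inner_orbit_bound[OF w, of t "k s"]] show ?thesis
      by (simp add: F_def norm_mult ac_simps)
  qed (simp add: F_def supp)
  define h where "h z = (LINT p|?P. F z p)" for z
  have h_hol: "h holomorphic_on UNIV"
    unfolding h_def
  proof (rule holomorphic_on_integral)
    show "(\<lambda>z. F z p) holomorphic_on UNIV" for p
      by (cases p) (auto simp: F_def intro!: holomorphic_intros)
    show "\<exists>B. integrable ?P B \<and> (\<forall>z p. norm z \<le> R \<longrightarrow> p \<in> space ?P \<longrightarrow> norm (F z p) \<le> B p)" for R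
      using dom[of "a / 2" "exp (a * (T * R)\<^sup>2) * norm w"] F_bound[of _ R] a
      by (intro exI[of _ "\<lambda>(t, s). exp (- (a / 2) * t\<^sup>2) * ((exp (a * (T * R)\<^sup>2) * norm w) * norm (k s))"]) auto
  qed (rule F_meas)
  have h_real: "h (of_real \<eta>) = of_real (LBINT t. exp (- a * t\<^sup>2) * (LINT s|lebesgue. inner (U (t + s * \<eta>) w) (k s)))"
    for \<eta> :: real
  proof -
    let ?f = "\<lambda>t s. exp (- a * (t - s * \<eta>)\<^sup>2) * inner (U t w) (k s)"
    let ?g = "\<lambda>t s. exp (- a * t\<^sup>2) * inner (U (t + s * \<eta>) w) (k s)"
    have F_eq: "F (of_real \<eta>) = (\<lambda>p. of_real (case p of (t, s) \<Rightarrow> ?f t s))"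
      by (auto simp: F_def exp_of_real[symmetric])
    have f_int: "integrable ?P (\<lambda>(t, s). ?f t s)"
    proof (rule Bochner_Integration.integrable_bound)
      show "integrable ?P (\<lambda>(t, s). exp (- (a / 2) * t\<^sup>2) * ((exp (a * (T * \<bar>\<eta>\<bar>)\<^sup>2) * norm w) * norm (k s)))"
        using a by (intro dom) simp
      have "norm (?f t s) \<le> exp (- (a / 2) * t\<^sup>2) * ((exp (a * (T * \<bar>\<eta>\<bar>)\<^sup>2) * norm w) * norm (k s))" for t s
        using F_bound[of "of_real \<eta>" "\<bar>\<eta>\<bar>" t s] unfolding F_eq by (simp add: norm_mult abs_mult)
      then show "AE p in ?P. norm (case p of (t, s) \<Rightarrow> ?f t s)
          \<le> norm (case p of (t, s) \<Rightarrow> exp (- (a / 2) * t\<^sup>2) * ((exp (a * (T * \<bar>\<eta>\<bar>)\<^sup>2) * norm w) * norm (k s)))"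
        by (auto simp: abs_mult)
    qed measurable
    have g_int: "integrable ?P (\<lambda>(t, s). ?g t s)"
    proof (rule Bochner_Integration.integrable_bound)
      show "integrable ?P (\<lambda>(t, s). exp (- a * t\<^sup>2) * (norm w * norm (k s)))"
        using a by (intro dom) simp
      show "AE p in ?P. norm (case p of (t, s) \<Rightarrow> ?g t s)
          \<le> norm (case p of (t, s) \<Rightarrow> exp (- a * t\<^sup>2) * (norm w * norm (k s)))"
        using inner_orbit_bound[OF w] by (auto simp: abs_mult)
    qed measurable
    have "h (of_real \<eta>) = of_real (LINT p|?P. (case p of (t, s) \<Rightarrow> ?f t s))"
      unfolding h_def F_eq by simp
    also have "(LINT p|?P. (case p of (t, s) \<Rightarrow> ?f t s)) = (LINT s|lebesgue. (LBINT t. ?f t s))"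
      using P.integral_snd[OF f_int] by simp
    also have "\<dots> = (LINT s|lebesgue. (LBINT t. ?g t s))"
    proof (rule Bochner_Integration.integral_cong)
      show "(LBINT t. ?f t s) = (LBINT t. ?g t s)" for s
        by (subst lborel_integral_real_affine[where c = 1 and t = "s * \<eta>"]) (simp_all add: ac_simps)
    qed simp
    also have "\<dots> = (LBINT t. (LINT s|lebesgue. ?g t s))"
      using P.Fubini_integral[OF g_int] .
    finally show ?thesis by simp
  qed
  have h_A: "h (of_real \<eta>) = - of_real c" if "\<eta> \<in> ?A" for \<eta>
  proof -
    have "(LINT s|lebesgue. inner (U (t + s * \<eta>) w) (k s)) = - inner (U t w) y" for t
    proof -
      have "U (s * \<eta>) (U t w) = U (t + s * \<eta>) w" for s
        using U_add[OF w, of "s * \<eta>" t] by (simp add: add.commute)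
      moreover have "inner (U t w) y + (LINT s|lebesgue. inner (U (s * \<eta>) (U t w)) (k s)) = 0"
        using that U_mem[OF w, of t] by blast
      ultimately show ?thesis by simp
    qed
    then show ?thesis unfolding h_real c_def by simp
  qed
  have I: "I \<ge> 0" by (simp add: I_def)
  have h_decay: "norm (h (of_real \<eta>)) \<le> I * (norm y * (LINT s|lebesgue. norm (k (- r / \<eta> + s) - k s)))"
    if "\<eta> \<noteq> 0" for \<eta>
  proof -
    define M where "M = norm y * (LINT s|lebesgue. norm (k (- r / \<eta> + s) - k s))"
    have "\<bar>LBINT t. exp (- a * t\<^sup>2) * (LINT s|lebesgue. inner (U (t + s * \<eta>) w) (k s))\<bar>
      \<le> (LBINT t. exp (- a * t\<^sup>2) * M)"
    proof -
      have "norm (LBINT t. exp (- a * t\<^sup>2) * (LINT s|lebesgue. inner (U (t + s * \<eta>) w) (k s)))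
         \<le> (LBINT t. norm (exp (- a * t\<^sup>2) * (LINT s|lebesgue. inner (U (t + s * \<eta>) w) (k s))))"
        by (rule integral_norm_bound)
      also have "\<dots> \<le> (LBINT t. exp (- a * t\<^sup>2) * M)"
        using integrable_gaussian[OF a] orbit_difference_bound[OF y(1) k that, of _ r]
        by (intro integral_mono_AE') (auto simp: abs_mult w_def M_def)
      finally show ?thesis by simp
    qed
    also have "\<dots> = I * M" using integrable_gaussian[OF a] by (simp add: I_def)
    finally show ?thesis unfolding h_real M_def by simp
  qed
  have "\<exists>N>0. \<forall>\<eta>. \<bar>\<eta>\<bar> \<ge> N \<longrightarrow> norm (h (of_real \<eta>)) < \<bar>c\<bar>"
  proof -
    \<comment> \<open>The summand 1 only ensures that the divisor below is positive.\<close>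
    define Q where "Q = I * norm y + 1"
    have Q: "Q > 0" "I * norm y \<le> Q" using I by (auto simp: Q_def intro: add_nonneg_pos)
    have "0 < \<bar>c\<bar> / Q" using c Q by (simp add: c_def)
    then obtain d where d: "d > 0" "\<And>h. \<bar>h\<bar> < d \<Longrightarrow> (LINT s|lebesgue. norm (k (h + s) - k s)) < \<bar>c\<bar> / Q"
      using L1_translation_continuous[OF k] by blast
    define N where "N = \<bar>r\<bar> / d + 1"
    have N: "N > 0" using d by (auto simp: N_def intro: add_nonneg_pos)
    have "norm (h (of_real \<eta>)) < \<bar>c\<bar>" if "\<bar>\<eta>\<bar> \<ge> N" for \<eta>
    proof -
      have \<eta>: "\<eta> \<noteq> 0" "\<bar>r\<bar> / d < \<bar>\<eta>\<bar>" using that N by (auto simp: N_def)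
      then have "\<bar>- r / \<eta>\<bar> < d" using d(1) by (simp add: abs_divide field_simps)
      note le = d(2)[OF this]
      have "norm (h (of_real \<eta>)) \<le> (I * norm y) * (LINT s|lebesgue. norm (k (- r / \<eta> + s) - k s))"
        using h_decay[OF \<eta>(1)] by (simp add: mult.assoc)
      also have "\<dots> \<le> Q * (LINT s|lebesgue. norm (k (- r / \<eta> + s) - k s))"
        using Q by (intro mult_right_mono) auto
      also have "\<dots> < Q * (\<bar>c\<bar> / Q)"
        using le Q by (intro mult_strict_left_mono) auto
      finally show ?thesis using Q by simp
    qed
    with N show ?thesis by blast
  qed
  then obtain N where N: "N > 0" "\<And>\<eta>. \<bar>\<eta>\<bar> \<ge> N \<Longrightarrow> norm (h (of_real \<eta>)) < \<bar>c\<bar>" by blast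
  show ?thesis
  proof (rule ccontr)
    assume inf: "infinite ?A"
    have "?A \<subseteq> {- N..N}"
    proof
      fix \<eta> assume "\<eta> \<in> ?A"
      then have "norm (h (of_real \<eta>)) = \<bar>c\<bar>" using h_A by simp
      then show "\<eta> \<in> {- N..N}" using N(2)[of \<eta>] by force
    qed
    then obtain l where l: "l islimpt ?A"
      using inf compact_imp_bounded[OF compact_Icc, of "- N" N]
        bounded_infinite_imp_islimpt[of ?A ?A] bounded_subset[of "{- N..N}" ?A] by blast
    have lim: "complex_of_real l islimpt (complex_of_real ` ?A)"
      using l unfolding islimpt_approachable
      by (metis (no_types, lifting) dist_of_real image_eqI of_real_eq_iff)
    have "h (of_real N) + of_real c = 0"
    proof (rule analytic_continuation[of "\<lambda>z. h z + of_real c" UNIV "complex_of_real ` ?A"])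
      show "(\<lambda>z. h z + of_real c) holomorphic_on UNIV" by (intro holomorphic_intros h_hol)
    qed (use lim h_A in auto)
    then have "norm (h (of_real N)) = \<bar>c\<bar>" by (simp add: eq_neg_iff_add_eq_0[symmetric])
    then show False using N(2)[of N] N(1) by simp
  qed
qed

end

section \<open>Injectivity of the Dirichlet Laplacian\<close>

lemma test_function_differentiable:
  assumes "\<phi> \<in> test_functions G"
  shows "\<phi> differentiable (at x)"
proof -
  have "C_k (Suc 0) \<phi>" using assms unfolding test_functions_def by blast
  then show ?thesis by simp
qed

lemma dir_deriv_test_function:
  assumes "\<phi> \<in> test_functions G"
  shows "dir_deriv b \<phi> \<in> test_functions G"
proof -
  let ?S = "closure {x. \<phi> x \<noteq> 0}"
  have C: "C_k k (dir_deriv b \<phi>)" for k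
  proof -
    have "C_k (Suc k) \<phi>" using assms unfolding test_functions_def by blast
    then show ?thesis by simp
  qed
  have "dir_deriv b \<phi> x = 0" if "x \<notin> ?S" for x
  proof -
    have "(\<phi> has_derivative (\<lambda>_. 0)) (at x)"
    proof (rule has_derivative_transform_within_open)
      show "((\<lambda>_. 0) has_derivative (\<lambda>_. 0)) (at x)" by simp
      show "open (- ?S)" "x \<in> - ?S" using that by auto
      show "0 = \<phi> y" if "y \<in> - ?S" for y
        using that closure_subset[of "{x. \<phi> x \<noteq> 0}"] by auto
    qed
    from frechet_derivative_at[OF this, symmetric] show ?thesis by (simp add: dir_deriv_def)
  qed
  then have "closure {x. dir_deriv b \<phi> x \<noteq> 0} \<subseteq> ?S"
    by (intro closure_minimal) auto
  moreover have "compact ?S" "?S \<subseteq> G" using assms by (auto simp: test_functions_def)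
  ultimately show ?thesis
    using C compact_Int_closed[of ?S "closure {x. dir_deriv b \<phi> x \<noteq> 0}"]
    by (auto simp: test_functions_def Int_absorb1)
qed

lemma dir_deriv_cnj:
  assumes "f differentiable (at x)"
  shows "dir_deriv v (\<lambda>x. cnj (f x)) x = cnj (dir_deriv v f x)"
proof -
  have "(f has_derivative frechet_derivative f (at x)) (at x)"
    using assms by (simp add: frechet_derivative_works)
  then have "((\<lambda>x. cnj (f x)) has_derivative (\<lambda>h. cnj (frechet_derivative f (at x) h))) (at x)"
    by (rule has_derivative_cnj)
  from frechet_derivative_at[OF this, symmetric] show ?thesis by (simp add: dir_deriv_def)
qed

lemma C_k_cnj: "C_k k f \<Longrightarrow> C_k k (\<lambda>x. cnj (f x))"
proof (induction k arbitrary: f)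
  case 0
  then show ?case by (auto intro: continuous_on_cnj)
next
  case (Suc k)
  then have diff: "f differentiable (at x)" for x by simp
  then have "dir_deriv v (\<lambda>x. cnj (f x)) = (\<lambda>x. cnj (dir_deriv v f x))" for v
    by (auto simp: dir_deriv_cnj)
  moreover have "(\<lambda>x. cnj (f x)) differentiable (at x)" for x
    using diff[of x] has_derivative_cnj unfolding differentiable_def by blast
  ultimately show ?case using Suc by simp
qed

lemma cnj_test_function:
  assumes "\<phi> \<in> test_functions G"
  shows "(\<lambda>x. cnj (\<phi> x)) \<in> test_functions G"
  using assms C_k_cnj[of _ \<phi>] by (simp add: test_functions_def)

lemma test_function_continuous:
  assumes "\<phi> \<in> test_functions G"
  shows "continuous_on UNIV \<phi>"
proof -
  have "C_k 0 \<phi>" using assms unfolding test_functions_def by blast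
  then show ?thesis by simp
qed

lemma test_function_square_integrable:
  assumes "\<phi> \<in> test_functions G"
  shows "square_integrable \<phi>"
proof -
  let ?S = "closure {x. \<phi> x \<noteq> 0}"
  have S: "compact ?S" using assms by (auto simp: test_functions_def)
  note cont = test_function_continuous[OF assms]
  have [measurable]: "\<phi> \<in> borel_measurable borel" using cont by (rule borel_measurable_continuous_onI)
  have "integrable lborel (\<lambda>x. indicator ?S x *\<^sub>R (cmod (\<phi> x))\<^sup>2)"
    by (rule borel_integrable_compact[OF S])
       (intro continuous_intros continuous_on_subset[OF cont subset_UNIV])
  also have "(\<lambda>x. indicator ?S x *\<^sub>R (cmod (\<phi> x))\<^sup>2) = (\<lambda>x. (cmod (\<phi> x))\<^sup>2)"
    using closure_subset[of "{x. \<phi> x \<noteq> 0}"] by (fastforce simp: indicator_def)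
  finally have "integrable lborel (\<lambda>x. (cmod (\<phi> x))\<^sup>2)" .
  then have "integrable lebesgue (\<lambda>x. (cmod (\<phi> x))\<^sup>2)"
    by (subst integrable_completion) auto
  then show ?thesis
    by (simp add: square_integrable_def measurable_completion)
qed

text \<open>
  The Cauchy--Schwarz inequality against the constant 1.
\<close>
lemma norm_integral_square_le:
  fixes g :: "real \<Rightarrow> 'b::euclidean_space"
  assumes g: "continuous_on {0..R} g" and R: "R > 0"
  shows "(norm (LBINT t. indicator {0..R} t *\<^sub>R g t))\<^sup>2
    \<le> R * (LBINT t. indicator {0..R} t *\<^sub>R (norm (g t))\<^sup>2)"
proof -
  define S where "S = (LBINT t. indicator {0..R} t *\<^sub>R (norm (g t))\<^sup>2)"
  define M where "M = (LBINT t. indicator {0..R} t *\<^sub>R norm (g t))"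
  have i1: "integrable lborel (\<lambda>t. indicator {0..R} t *\<^sub>R norm (g t))"
    and i2: "integrable lborel (\<lambda>t. indicator {0..R} t *\<^sub>R (norm (g t))\<^sup>2)"
    by (intro borel_integrable_compact continuous_intros g compact_Icc)+
  have i0: "integrable lborel (indicat_real {0..R})" using R by (intro integrable_real_indicator) auto
  have "norm (LBINT t. indicator {0..R} t *\<^sub>R g t) \<le> M"
    using integral_norm_bound[of lborel "\<lambda>t. indicator {0..R} t *\<^sub>R g t"] by (simp add: M_def)
  then have "(norm (LBINT t. indicator {0..R} t *\<^sub>R g t))\<^sup>2 \<le> M\<^sup>2"
    by (rule power_mono) simp
  also have "M\<^sup>2 \<le> R * S"
  proof -
    \<comment> \<open>\<open>m\<close> is the mean of the norm of \<open>g\<close>; integrate the inequality $2m|g| \le m^2 + |g|^2$.\<close>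
    define m where "m = M / R"
    have "(LBINT t. 2 * m * (indicator {0..R} t *\<^sub>R norm (g t)))
      \<le> (LBINT t. m\<^sup>2 * indicator {0..R} t + indicator {0..R} t *\<^sub>R (norm (g t))\<^sup>2)"
    proof (rule integral_mono)
      have "2 * m * norm (g t) \<le> m\<^sup>2 + (norm (g t))\<^sup>2" for t
        using zero_le_power2[of "m - norm (g t)"] by (simp add: power2_eq_square algebra_simps)
      then show "2 * m * (indicator {0..R} t *\<^sub>R norm (g t))
        \<le> m\<^sup>2 * indicator {0..R} t + indicator {0..R} t *\<^sub>R (norm (g t))\<^sup>2" for t
        by (simp add: indicator_def)
    qed (intro Bochner_Integration.integrable_add integrable_mult_right i0 i1 i2)+
    also have "\<dots> = m\<^sup>2 * R + S" using i0 i2 R by (simp add: S_def)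
    also have "(LBINT t. 2 * m * (indicator {0..R} t *\<^sub>R norm (g t))) = 2 * m * M"
      by (simp add: M_def)
    finally show ?thesis using R by (simp add: m_def power2_eq_square field_simps)
  qed
  finally show ?thesis by (simp add: S_def)
qed

lemma nn_integral_lborel_shift:
  assumes "f \<in> borel_measurable borel"
  shows "(\<integral>\<^sup>+x. f (x + c) \<partial>lborel) = (\<integral>\<^sup>+x. f x \<partial>(lborel :: 'a::euclidean_space measure))"
proof -
  have "(\<integral>\<^sup>+x. f x \<partial>(lborel :: 'a measure)) = (\<integral>\<^sup>+x. f x \<partial>distr lborel borel ((+) c))"
    by (simp add: lborel_distr_plus)
  also have "\<dots> = (\<integral>\<^sup>+x. f (c + x) \<partial>lborel)"
    using assms by (intro nn_integral_distr) auto
  finally show ?thesis by (simp add: add.commute)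
qed

lemma norm_to_l2_test_function:
  assumes "\<phi> \<in> test_functions G"
  shows "ennreal ((norm (to_l2 \<phi>))\<^sup>2) = (\<integral>\<^sup>+x. ennreal ((cmod (\<phi> x))\<^sup>2) \<partial>lborel)"
proof -
  note si = test_function_square_integrable[OF assms]
  have "ennreal ((norm (to_l2 \<phi>))\<^sup>2) = (\<integral>\<^sup>+x. ennreal ((cmod (\<phi> x))\<^sup>2) \<partial>lebesgue)"
    using si by (simp add: to_l2_def norm_l2_abs nn_integral_eq_integral square_integrable_integrable)
  then show ?thesis by (simp add: nn_integral_completion)
qed

text \<open>
  A point of \<open>G\<close> leaves \<open>G\<close> when it is moved by $2r$ along \<open>b\<close>, so $\varphi$ is minus the integral of its
  derivative along that segment. Cauchy--Schwarz on the segment, Fubini and the translation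
  invariance of Lebesgue measure give the estimate.
\<close>
lemma poincare_inequality:
  assumes b: "norm b = 1" and G: "G \<subseteq> ball 0 r" and phi: "\<phi> \<in> test_functions G" and r: "r > 0"
  shows "norm (to_l2 \<phi>) \<le> 2 * r * norm (to_l2 (dir_deriv b \<phi>))"
proof -
  define R where "R = 2 * r"
  have R: "R > 0" using r by (simp add: R_def)
  let ?D = "dir_deriv b \<phi>"
  have D: "?D \<in> test_functions G" by (rule dir_deriv_test_function[OF phi])
  have [measurable]: "\<phi> \<in> borel_measurable borel" "?D \<in> borel_measurable borel"
    using phi D by (auto intro: borel_measurable_continuous_onI test_function_continuous)
  have Dcont: "continuous_on A (\<lambda>t. ?D (x + t *\<^sub>R b))" for A :: "real set" and x
    by (rule continuous_on_compose2[OF test_function_continuous[OF D]]) (auto intro!: continuous_intros)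
  have outside: "\<phi> x = 0" if "x \<notin> G" for x
    using phi that closure_subset[of "{x. \<phi> x \<noteq> 0}"] by (auto simp: test_functions_def)
  have pointwise: "(cmod (\<phi> x))\<^sup>2 \<le> R * (LBINT t. indicator {0..R} t *\<^sub>R (cmod (?D (x + t *\<^sub>R b)))\<^sup>2)" for x
  proof (cases "x \<in> G")
    case True
    have "x + R *\<^sub>R b \<notin> G"
    proof
      assume "x + R *\<^sub>R b \<in> G"
      with True G have "norm x < r" "norm (x + R *\<^sub>R b) < r" by auto
      moreover have "norm (R *\<^sub>R b) \<le> norm (x + R *\<^sub>R b) + norm x"
        using norm_triangle_ineq4[of "x + R *\<^sub>R b" x] by simp
      ultimately show False using b R by (simp add: R_def)
    qed
    then have end0: "\<phi> (x + R *\<^sub>R b) = 0" by (rule outside)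
    have "(LBINT t. indicator {0..R} t *\<^sub>R ?D (x + t *\<^sub>R b)) = \<phi> (x + R *\<^sub>R b) - \<phi> (x + 0 *\<^sub>R b)"
    proof (rule integral_FTC_Icc)
      fix t :: real
      let ?\<phi>' = "frechet_derivative \<phi> (at (x + t *\<^sub>R b))"
      have "(\<phi> has_derivative ?\<phi>') (at (x + t *\<^sub>R b))"
        using test_function_differentiable[OF phi] by (simp add: frechet_derivative_works)
      moreover have "((\<lambda>t. x + t *\<^sub>R b) has_derivative (\<lambda>h. h *\<^sub>R b)) (at t within {0..R})"
        by (auto intro!: derivative_eq_intros)
      ultimately have "((\<lambda>t. \<phi> (x + t *\<^sub>R b)) has_derivative (\<lambda>h. ?\<phi>' (h *\<^sub>R b))) (at t within {0..R})"
        by (rule has_derivative_compose[rotated])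
      moreover have "?\<phi>' (h *\<^sub>R b) = h *\<^sub>R ?D (x + t *\<^sub>R b)" for h
        using linear_frechet_derivative[OF test_function_differentiable[OF phi]]
        by (simp add: dir_deriv_def linear_scale)
      ultimately show "((\<lambda>t. \<phi> (x + t *\<^sub>R b)) has_vector_derivative ?D (x + t *\<^sub>R b)) (at t within {0..R})"
        by (simp add: has_vector_derivative_def)
    qed (use R Dcont in auto)
    then have "cmod (\<phi> x) = norm (LBINT t. indicator {0..R} t *\<^sub>R ?D (x + t *\<^sub>R b))"
      using end0 by simp
    then show ?thesis using norm_integral_square_le[OF Dcont R] by simp
  next
    case False
    then show ?thesis using outside R
      by (auto intro!: mult_nonneg_nonneg Bochner_Integration.integral_nonneg)
  qed
  have "(\<integral>\<^sup>+x. ennreal ((cmod (\<phi> x))\<^sup>2) \<partial>lborel)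
    \<le> (\<integral>\<^sup>+x. ennreal R * (\<integral>\<^sup>+t. indicator {0..R} t * ennreal ((cmod (?D (x + t *\<^sub>R b)))\<^sup>2) \<partial>lborel) \<partial>lborel)"
  proof (rule nn_integral_mono)
    fix x
    have "ennreal (LBINT t. indicator {0..R} t *\<^sub>R (cmod (?D (x + t *\<^sub>R b)))\<^sup>2)
       = (\<integral>\<^sup>+t. ennreal (indicator {0..R} t *\<^sub>R (cmod (?D (x + t *\<^sub>R b)))\<^sup>2) \<partial>lborel)"
      by (intro nn_integral_eq_integral[symmetric] borel_integrable_compact continuous_intros Dcont) auto
    also have "\<dots> = (\<integral>\<^sup>+t. indicator {0..R} t * ennreal ((cmod (?D (x + t *\<^sub>R b)))\<^sup>2) \<partial>lborel)"
      by (intro nn_integral_cong) (auto simp: indicator_def)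
    finally show "ennreal ((cmod (\<phi> x))\<^sup>2)
      \<le> ennreal R * (\<integral>\<^sup>+t. indicator {0..R} t * ennreal ((cmod (?D (x + t *\<^sub>R b)))\<^sup>2) \<partial>lborel)"
      using ennreal_leI[OF pointwise[of x]] R by (simp add: ennreal_mult')
  qed
  also have "\<dots> = ennreal R *
      (\<integral>\<^sup>+t. (\<integral>\<^sup>+x. indicator {0..R} t * ennreal ((cmod (?D (x + t *\<^sub>R b)))\<^sup>2) \<partial>lborel) \<partial>lborel)"
    by (subst nn_integral_cmult, measurable) (subst lborel_pair.Fubini', auto)
  also have "\<dots> = ennreal R *
      (\<integral>\<^sup>+t. indicator {0..R} t * (\<integral>\<^sup>+x. ennreal ((cmod (?D x))\<^sup>2) \<partial>lborel) \<partial>lborel)"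
    using nn_integral_lborel_shift[of "\<lambda>x. ennreal ((cmod (?D x))\<^sup>2)"]
    by (simp add: nn_integral_cmult)
  also have "\<dots> = ennreal R * (ennreal R * (\<integral>\<^sup>+x. ennreal ((cmod (?D x))\<^sup>2) \<partial>lborel))"
    using R by (simp add: nn_integral_multc)
  finally have "ennreal ((norm (to_l2 \<phi>))\<^sup>2) \<le> ennreal (R * (R * (norm (to_l2 ?D))\<^sup>2))"
    using R by (simp add: norm_to_l2_test_function[OF phi, symmetric]
      norm_to_l2_test_function[OF D, symmetric] ennreal_mult')
  then have "(norm (to_l2 \<phi>))\<^sup>2 \<le> (R * norm (to_l2 ?D))\<^sup>2"
    using R by (simp add: power_mult_distrib power2_eq_square ac_simps)
  then show ?thesis
    unfolding R_def[symmetric] by (rule power2_le_imp_le) (use R in simp)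
qed

lemma inner_to_l2:
  assumes "square_integrable h"
  shows "inner f (to_l2 h) = Re (LINT x|lebesgue. rep_l2 f x * cnj (h x))"
  using inner_l2.abs_eq[of "rep_l2 f" h] assms
  by (simp add: abs_rep_l2 to_l2_def l2_rel_def rep_l2_square_integrable)

lemma rep_l2_0: "AE x in lebesgue. rep_l2 (0 :: 'a::euclidean_space l2) x = 0"
  using abs_l2_eq_iff[OF rep_l2_square_integrable square_integrable_0, of "0 :: 'a l2"]
  by (simp add: abs_rep_l2 abs_l2_0)

text \<open>
  Formally, $0 = -\int \Delta f\,\overline{f} = \int |\nabla f|^2$, and the Poincare inequality gives
  $f = 0$. Here one factor is replaced by a test function $\varphi$ which is $\varepsilon$-close to \<open>f\<close> in
  $H^1$: then $\sum_b \langle g_b, \partial_b\varphi\rangle = 0$ for weak derivatives $g_b$ that are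
  $\varepsilon$-close to $\partial_b\varphi$, and hence $\nabla\varphi$ is small. The $g_b$ are those supplied by
  \<open>sobolev_H10\<close> for this $\varepsilon$ and may change with it.
\<close>
lemma dirichlet_laplacian_injective:
  fixes G :: "'a::euclidean_space set"
  assumes G: "bounded G" and f: "(f, 0) \<in> dirichlet_laplacian G"
  shows "f = 0"
proof -
  have fH: "f \<in> sobolev_H10 G"
    and harmonic: "\<And>\<psi>. \<psi> \<in> test_functions G \<Longrightarrow> (LINT x|lebesgue. rep_l2 f x * laplacian \<psi> x) = 0"
  proof -
    show "f \<in> sobolev_H10 G" using f by (auto simp: dirichlet_laplacian_def)
    fix \<psi> assume psi: "\<psi> \<in> test_functions G"
    have "(LINT x|lebesgue. rep_l2 f x * laplacian \<psi> x) = (LINT x|lebesgue. rep_l2 (0 :: 'a l2) x * \<psi> x)"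
      using f psi by (auto simp: dirichlet_laplacian_def)
    also have "\<dots> = 0"
      by (rule integral_eq_zero_AE) (use rep_l2_0 in \<open>auto elim: eventually_mono\<close>)
    finally show "(LINT x|lebesgue. rep_l2 f x * laplacian \<psi> x) = 0" .
  qed
  obtain r where r: "r > 0" "G \<subseteq> ball 0 r"
    using bounded_subset_ballD[OF G, of 0] by auto
  obtain b0 :: 'a where b0: "b0 \<in> Basis" using nonempty_Basis by blast
  define n where "n = real (DIM('a))"
  have "norm f \<le> (1 + 2 * r * sqrt n) * \<epsilon>" if eps: "\<epsilon> > 0" for \<epsilon>
  proof -
    obtain \<phi> where phi: "\<phi> \<in> test_functions G" and near: "norm (f - to_l2 \<phi>) < \<epsilon>"
      and "\<forall>b\<in>Basis. \<exists>g. weak_partial G b f g \<and> norm (g - to_l2 (dir_deriv b \<phi>)) < \<epsilon>"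
      using fH eps by (auto simp: sobolev_H10_def)
    then obtain g where g: "\<And>b. b \<in> Basis \<Longrightarrow> weak_partial G b f (g b)"
        "\<And>b. b \<in> Basis \<Longrightarrow> norm (g b - to_l2 (dir_deriv b \<phi>)) < \<epsilon>"
      by metis
    define D where "D b = to_l2 (dir_deriv b \<phi>)" for b
    let ?\<psi> = "\<lambda>x. cnj (\<phi> x)"
    have psi: "?\<psi> \<in> test_functions G" by (rule cnj_test_function[OF phi])
    have dpsi: "dir_deriv b ?\<psi> = (\<lambda>x. cnj (dir_deriv b \<phi> x))" for b
      using dir_deriv_cnj[OF test_function_differentiable[OF phi]] by auto
    have ddpsi: "dir_deriv b (dir_deriv b ?\<psi>) \<in> test_functions G" for b
      by (intro dir_deriv_test_function psi)
    have int: "integrable lebesgue (\<lambda>x. rep_l2 f x * dir_deriv b (dir_deriv b ?\<psi>) x)" for b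
      using square_integrable_prod[OF rep_l2_square_integrable
        test_function_square_integrable[OF cnj_test_function[OF ddpsi]], of f b] by simp
    \<comment> \<open>The weak derivative is paired with a test function without conjugation, so it is tested
      against derivatives of the conjugate of \<open>\<phi>\<close>.\<close>
    have green: "inner (g b) (D b) = - Re (LINT x|lebesgue. rep_l2 f x * dir_deriv b (dir_deriv b ?\<psi>) x)"
      if "b \<in> Basis" for b
    proof -
      have "(LINT x|lebesgue. rep_l2 f x * dir_deriv b (dir_deriv b ?\<psi>) x)
        = - (LINT x|lebesgue. rep_l2 (g b) x * dir_deriv b ?\<psi> x)"
        using g(1)[OF that] dir_deriv_test_function[OF psi, of b] by (auto simp: weak_partial_def)
      then show ?thesis
        unfolding D_def inner_to_l2[OF test_function_square_integrable[OF dir_deriv_test_function[OF phi]]]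
        by (simp add: dpsi)
    qed
    have orth: "(\<Sum>b\<in>Basis. inner (g b) (D b)) = 0"
    proof -
      have "(\<Sum>b\<in>Basis. inner (g b) (D b))
        = - Re (\<Sum>b\<in>Basis. LINT x|lebesgue. rep_l2 f x * dir_deriv b (dir_deriv b ?\<psi>) x)"
        using green by (simp add: sum_negf)
      also have "(\<Sum>b\<in>Basis. LINT x|lebesgue. rep_l2 f x * dir_deriv b (dir_deriv b ?\<psi>) x)
        = (LINT x|lebesgue. rep_l2 f x * laplacian ?\<psi> x)"
        unfolding laplacian_def sum_distrib_left by (rule Bochner_Integration.integral_sum[symmetric]) (rule int)
      also have "\<dots> = 0" by (rule harmonic[OF psi])
      finally show ?thesis by simp
    qed
    have "(\<Sum>b\<in>Basis. (norm (D b))\<^sup>2) = (\<Sum>b\<in>Basis. inner (D b - g b) (D b))"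
      using orth by (simp add: inner_diff_left sum_subtractf power2_norm_eq_inner)
    also have "\<dots> \<le> (\<Sum>b\<in>Basis. (\<epsilon>\<^sup>2 + (norm (D b))\<^sup>2) / 2)"
    proof (rule sum_mono)
      fix b :: 'a assume b: "b \<in> Basis"
      have "inner (D b - g b) (D b) \<le> norm (D b - g b) * norm (D b)" by (rule norm_cauchy_schwarz)
      also have "\<dots> \<le> \<epsilon> * norm (D b)"
        using g(2)[OF b] by (intro mult_right_mono) (auto simp: D_def norm_minus_commute)
      also have "\<dots> \<le> (\<epsilon>\<^sup>2 + (norm (D b))\<^sup>2) / 2"
        using zero_le_power2[of "\<epsilon> - norm (D b)"] by (simp add: power2_eq_square algebra_simps)
      finally show "inner (D b - g b) (D b) \<le> (\<epsilon>\<^sup>2 + (norm (D b))\<^sup>2) / 2" .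
    qed
    also have "\<dots> = (n * \<epsilon>\<^sup>2 + (\<Sum>b\<in>Basis. (norm (D b))\<^sup>2)) / 2"
      by (simp add: sum.distrib sum_divide_distrib[symmetric] n_def)
    finally have "(\<Sum>b\<in>Basis. (norm (D b))\<^sup>2) \<le> n * \<epsilon>\<^sup>2" by simp
    moreover have "(norm (D b0))\<^sup>2 \<le> (\<Sum>b\<in>Basis. (norm (D b))\<^sup>2)"
      by (rule member_le_sum[OF b0]) auto
    ultimately have "(norm (D b0))\<^sup>2 \<le> n * \<epsilon>\<^sup>2" by simp
    then have "norm (D b0) \<le> sqrt (n * \<epsilon>\<^sup>2)" by (rule real_le_rsqrt)
    then have "2 * r * norm (D b0) \<le> 2 * r * (sqrt n * \<epsilon>)"
      using eps r by (intro mult_left_mono) (simp_all add: real_sqrt_mult)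
    moreover have "norm (to_l2 \<phi>) \<le> 2 * r * norm (D b0)"
      unfolding D_def using poincare_inequality[OF norm_Basis[OF b0] r(2) phi r(1)] .
    ultimately have "norm (to_l2 \<phi>) \<le> 2 * r * (sqrt n * \<epsilon>)" by linarith
    moreover have "norm f \<le> norm (f - to_l2 \<phi>) + norm (to_l2 \<phi>)"
      using norm_triangle_ineq[of "f - to_l2 \<phi>" "to_l2 \<phi>"] by simp
    ultimately show ?thesis using near by (simp add: algebra_simps)
  qed
  note small = this
  have K: "1 + 2 * r * sqrt n > 0" using r by (auto simp: n_def intro!: add_pos_nonneg mult_nonneg_nonneg)
  have "norm f \<le> e" if "e > 0" for e
    using small[of "e / (1 + 2 * r * sqrt n)"] that K by (simp add: divide_pos_pos)
  then have "norm f \<le> 0" by (rule field_le_epsilon) simp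
  then show ?thesis by simp
qed

section \<open>The Schroedinger group and finiteness\<close>

lemma rep_abs_l2: "square_integrable f \<Longrightarrow> AE x in lebesgue. rep_l2 (abs_l2 f) x = f x"
  using abs_l2_eq_iff[OF rep_l2_square_integrable, of f "abs_l2 f"] by (simp add: abs_rep_l2)

lemma L2_on_diff:
  assumes "f \<in> L2_on G" "g \<in> L2_on G"
  shows "f - g \<in> L2_on G"
proof -
  have "AE x in lebesgue. rep_l2 (abs_l2 (\<lambda>x. rep_l2 f x - rep_l2 g x)) x = rep_l2 f x - rep_l2 g x"
    by (intro rep_abs_l2 square_integrable_diff rep_l2_square_integrable)
  then have "AE x in lebesgue. rep_l2 (f - g) x = rep_l2 f x - rep_l2 g x"
    by (simp add: abs_l2_diff rep_l2_square_integrable abs_rep_l2)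
  with assms show ?thesis
    unfolding L2_on_def by auto
qed

lemma scaleC_l2_eq_0_iff:
  assumes "c \<noteq> 0"
  shows "c *\<^sub>C f = 0 \<longleftrightarrow> f = 0"
proof -
  have "c *\<^sub>C f = abs_l2 (\<lambda>x. c * rep_l2 f x)"
    using scaleC_l2.abs_eq[of "rep_l2 f" c] by (simp add: l2_rel_def rep_l2_square_integrable abs_rep_l2)
  also have "\<dots> = abs_l2 (\<lambda>_. 0) \<longleftrightarrow> (AE x in lebesgue. c * rep_l2 f x = 0)"
    by (intro abs_l2_eq_iff square_integrable_mult rep_l2_square_integrable square_integrable_0)
  also have "\<dots> \<longleftrightarrow> (AE x in lebesgue. rep_l2 f x = 0)" using assms by simp
  also have "\<dots> \<longleftrightarrow> abs_l2 (rep_l2 f) = abs_l2 (\<lambda>_. 0)"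
    by (intro abs_l2_eq_iff[symmetric] rep_l2_square_integrable square_integrable_0)
  finally show ?thesis by (simp add: abs_l2_0 abs_rep_l2)
qed

lemma control_slice_L2_on:
  assumes "G0 \<subseteq> G"
  shows "control_slice G0 u s \<in> L2_on G"
proof (cases "square_integrable (\<lambda>x. indicat_real G0 x *\<^sub>R rep_l2 u (s, x))")
  case True
  from rep_abs_l2[OF this] True assms show ?thesis
    by (auto simp: control_slice_def to_l2_def L2_on_def indicator_def elim!: eventually_mono)
next
  case False
  then show ?thesis
    using rep_l2_0 by (auto simp: control_slice_def to_l2_def L2_on_def elim!: eventually_mono)
qed

lemma unitary_group_imp_isometry_group:
  assumes "unitary_group_on (L2_on G) U"
  shows "isometry_group (L2_on G) U"
proof
  have un: "unitary_on (L2_on G) (U t)" for t using assms by (simp add: unitary_group_on_def)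
  show mem: "U t f \<in> L2_on G" if "f \<in> L2_on G" for t f
    using un[of t] that by (auto simp: unitary_on_def dest: bij_betwE)
  show "U t (f - g) = U t f - U t g" if "f \<in> L2_on G" "g \<in> L2_on G" for t f g
  proof -
    have "U t ((f - g) + g) = U t (f - g) + U t g"
      using un[of t] L2_on_diff[OF that] that unfolding unitary_on_def by blast
    then show ?thesis by simp
  qed
  show "norm (U t f) = norm f" if "f \<in> L2_on G" for t f
    using un[of t] that by (simp add: unitary_on_def)
qed (use assms L2_on_diff in \<open>auto simp: unitary_group_on_def\<close>)

text \<open>
  A vector fixed by the whole group has a constant orbit, so the generator annihilates it, and the
  generator is injective by \<open>dirichlet_laplacian_injective\<close>.
\<close>
lemma schroedinger_group_moves:
  assumes G: "bounded G" and U: "dirichlet_schroedinger_group G U" and y: "y \<in> L2_on G" "y \<noteq> 0"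
  shows "\<exists>r. U r y \<noteq> y"
proof (rule ccontr)
  assume "\<not> ?thesis"
  then have "(\<lambda>t. U t y) = (\<lambda>t. y)" by auto
  moreover have "0 \<in> L2_on G" using L2_on_diff[OF y(1) y(1)] by simp
  ultimately have "(y, 0) \<in> generator_on (L2_on G) U"
    using y by (simp add: generator_on_def)
  then obtain g where "(y, g) \<in> dirichlet_laplacian G" "\<i> *\<^sub>C g = 0"
    using U by (auto simp: dirichlet_schroedinger_group_def)
  then have "y = 0"
    using dirichlet_laplacian_injective[OF G] by (simp add: scaleC_l2_eq_0_iff)
  with y show False by simp
qed

theorem theorem4p4:
  fixes G G0 :: "'a::euclidean_space set"
    and T :: real
    and y0 :: "'a l2"
    and u :: "(real \<times> 'a) l2"
    and U :: "real \<Rightarrow> 'a l2 \<Rightarrow> 'a l2"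
  assumes "lipschitz_domain G" and "bounded G"
    and "dirichlet_schroedinger_group G U"
    and "G0 \<subseteq> G" and "G0 \<noteq> {}" and "G0 \<in> sets lebesgue" and "emeasure lebesgue G0 > 0"
    and "T > 0"
    and "y0 \<in> L2_on G" and "y0 \<noteq> 0"
    and "u \<in> L2_on ({0<..<T} \<times> G0)"
  shows "finite {\<xi>::real. schroedinger_solution U G0 \<xi> y0 u T = 0}"
proof -
  let ?A = "{\<xi>::real. schroedinger_solution U G0 \<xi> y0 u T = 0}"
  let ?H = "L2_on G"
  interpret isometry_group ?H U
    using assms(3) by (intro unitary_group_imp_isometry_group) (simp add: dirichlet_schroedinger_group_def)
  note y0 = \<open>y0 \<in> ?H\<close> \<open>y0 \<noteq> 0\<close>
  define c where "c s = control_slice G0 u s" for s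
  have c: "c s \<in> ?H" for s
    unfolding c_def using assms(4) by (rule control_slice_L2_on)
  define m where "m \<xi> s = indicator {0..T} s *\<^sub>R U ((T - s) * \<xi>) (c s)" for \<xi> s
  have sol: "schroedinger_solution U G0 \<xi> y0 u T = U (T * \<xi>) y0 + (LINT s|lebesgue. m \<xi> s)" for \<xi>
    by (simp add: schroedinger_solution_def set_lebesgue_integral_def m_def c_def)
  \<comment> \<open>A Bochner integral is 0 by convention if the integrand is not integrable, and then the solution
    is the free evolution of \<open>y0\<close>, which does not vanish. So \<open>\<xi> \<in> ?A\<close> itself provides the
    integrability of \<open>m \<xi>\<close>.\<close>
  have m_int: "integrable lebesgue (m \<xi>)" if "\<xi> \<in> ?A" for \<xi>
  proof (rule ccontr)
    assume "\<not> ?thesis"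
    then have "U (T * \<xi>) y0 = 0" using that by (simp add: sol not_integrable_integral_eq)
    then show False using U_norm[OF y0(1), of "T * \<xi>"] y0(2) by simp
  qed
  \<comment> \<open>Recentre at \<open>\<xi>0\<close>: pulling the equation for \<open>\<xi>\<close> back by the unitary \<open>U (T * (\<xi> - \<xi>0))\<close>
    leaves the integrand \<open>m \<xi>0\<close>, whose integrability is known, and only the orbit of \<open>x\<close>
    depends on \<open>\<xi>\<close>.\<close>
  have annihilates: "inner x (U (T * \<xi>0) y0) + (LINT s|lebesgue. inner (U (s * (\<xi> - \<xi>0)) x) (m \<xi>0 s)) = 0"
    if \<xi>: "\<xi> \<in> ?A" and x: "x \<in> ?H" for \<xi> \<xi>0 x
  proof -
    let ?\<eta> = "\<xi> - \<xi>0"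
    define v where "v = U (T * ?\<eta>) x"
    have "U (T * \<xi>) y0 = U (T * ?\<eta>) (U (T * \<xi>0) y0)"
      using U_add[OF y0(1), of "T * ?\<eta>" "T * \<xi>0"] by (simp add: algebra_simps)
    then have initial: "inner v (U (T * \<xi>) y0) = inner x (U (T * \<xi>0) y0)"
      unfolding v_def using U_inner[OF x U_mem[OF y0(1)]] by simp
    have forcing: "inner v (m \<xi> s) = inner (U (s * ?\<eta>) x) (m \<xi>0 s)" for s
    proof -
      have "v = U ((T - s) * ?\<eta>) (U (s * ?\<eta>) x)"
        unfolding v_def using U_add[OF x, of "(T - s) * ?\<eta>" "s * ?\<eta>"] by (simp add: algebra_simps)
      moreover have "U ((T - s) * \<xi>) (c s) = U ((T - s) * ?\<eta>) (U ((T - s) * \<xi>0) (c s))"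
        using U_add[OF c, of "(T - s) * ?\<eta>" "(T - s) * \<xi>0" s] by (simp add: algebra_simps)
      ultimately show ?thesis
        using U_inner[OF U_mem[OF x] U_mem[OF c]] by (simp add: m_def)
    qed
    have "0 = inner v (U (T * \<xi>) y0 + (LINT s|lebesgue. m \<xi> s))"
      using \<xi> by (simp add: sol)
    also have "\<dots> = inner v (U (T * \<xi>) y0) + (LINT s|lebesgue. inner v (m \<xi> s))"
      using m_int[OF \<xi>] by (simp add: inner_add_right)
    finally show ?thesis unfolding initial forcing by simp
  qed
  show ?thesis
  proof (cases "?A = {}")
    case False
    then obtain \<xi>0 where \<xi>0: "\<xi>0 \<in> ?A" by blast
    define y where "y = U (T * \<xi>0) y0"
    have y: "y \<in> ?H" "y \<noteq> 0"
      using U_mem[OF y0(1)] U_norm[OF y0(1), of "T * \<xi>0"] y0(2) by (auto simp: y_def)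
    obtain r where r: "U r y \<noteq> y"
      using schroedinger_group_moves[OF assms(2,3) y] by blast
    let ?B = "{\<eta>. \<forall>x\<in>?H. inner x y + (LINT s|lebesgue. inner (U (s * \<eta>) x) (m \<xi>0 s)) = 0}"
    have "finite ?B"
      by (rule annihilating_parameters_finite[OF m_int[OF \<xi>0] _ y(1) r, of T])
         (auto simp: m_def indicator_def)
    moreover have "?A \<subseteq> (\<lambda>\<eta>. \<eta> + \<xi>0) ` ?B"
    proof
      fix \<xi> assume "\<xi> \<in> ?A"
      then have "\<xi> - \<xi>0 \<in> ?B" using annihilates unfolding y_def by blast
      then show "\<xi> \<in> (\<lambda>\<eta>. \<eta> + \<xi>0) ` ?B" by (intro image_eqI[of _ _ "\<xi> - \<xi>0"]) auto
    qed
    ultimately show ?thesis using finite_surj by blast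
  qed simp
qed

end
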